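(* Let $n \ge m$ and let $X \in \mathbb{R}^{n\times m}$ be an orthogonal design, i.e. $X^\top X = I_m$. Suppose $y = X\beta + \epsilon$ with unknown $\beta \in \mathbb{R}^m$ and noise $\epsilon \sim N(0,\sigma^2 I_n)$ with known $\sigma>0$. Fix $\alpha,\gamma\in(0,1)$ and define, for $i=1,\dots,m$, $$\lambda_{\mathrm{FDP}}(i)=\Phi^{-1}\!\left(1-\frac{(\lfloor \gamma i\rfloor+1)\,\alpha}{2\,(m+\lfloor\gamma i\rfloor+1-i)}\right).$$ Let $\hat\beta$ be the F-SLOPE estimator $$\hat\beta \in \arg\min_{b\in\mathbb{R}^m}\ \frac12\|y-Xb\|_2^2+\sigma\sum_{i=1}^m \lambda_{\mathrm{FDP}}(i)\,|b|_{(i)}.$$ Let $R$ be the number of indices $i$ with $\hat\beta_i\neq0$, let $V$ be the number of indices $i$ with $\beta_i=0$ but $\hat\beta_i\neq 0$, and let $\mathrm{FDP}=V/\max\{R,1\}$. Then $$\mathrm{Prob}\{\mathrm{FDP}>\gamma\}\le\alpha.$$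
   Context: $\Phi$ denotes the cumulative distribution function of the standard normal distribution and $\Phi^{-1}$ its inverse; $\lfloor\cdot\rfloor$ is the floor function. For $b\in\mathbb{R}^m$, $|b|_{(1)}\ge |b|_{(2)}\ge\cdots\ge |b|_{(m)}$ denote the absolute values of the entries of $b$ sorted in non-increasing order. Feature $i$ is "selected" (the null hypothesis $H_i:\beta_i=0$ is rejected) when $\hat\beta_i\neq 0$. *)

theory Defs
  imports "HOL-Probability.Probability"
begin

definition Phi :: "real \<Rightarrow> real" where
  "Phi x = measure (density lborel (normal_density 0 1)) {..x}"

definition Phi_inv :: "real \<Rightarrow> real" where
  "Phi_inv p = (THE x. Phi x = p)"

definition lambda_FDP :: "nat \<Rightarrow> real \<Rightarrow> real \<Rightarrow> nat \<Rightarrow> real" where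
  "lambda_FDP m \<alpha> \<gamma> i =
     Phi_inv (1 - (real (nat \<lfloor>\<gamma> * real i\<rfloor>) + 1) * \<alpha>
                / (2 * (real m + real (nat \<lfloor>\<gamma> * real i\<rfloor>) + 1 - real i)))"

text \<open>|b|_(1) \<ge> ... \<ge> |b|_(m): absolute values of b 0, ..., b (m-1) sorted non-increasingly;
  |b|_(i) = sorted_abs m b ! (i - 1).\<close>
definition sorted_abs :: "nat \<Rightarrow> (nat \<Rightarrow> real) \<Rightarrow> real list" where
  "sorted_abs m b = rev (sort (map (\<lambda>j. \<bar>b j\<bar>) [0..<m]))"

definition fslope_obj ::
  "nat \<Rightarrow> nat \<Rightarrow> (nat \<Rightarrow> nat \<Rightarrow> real) \<Rightarrow> real \<Rightarrow> real \<Rightarrow> real \<Rightarrow> (nat \<Rightarrow> real) \<Rightarrow> (nat \<Rightarrow> real) \<Rightarrow> real"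
  where
  "fslope_obj n m X \<sigma> \<alpha> \<gamma> y b =
     (1/2) * (\<Sum>i<n. (y i - (\<Sum>j<m. X i j * b j))\<^sup>2)
     + \<sigma> * (\<Sum>i=1..m. lambda_FDP m \<alpha> \<gamma> i * (sorted_abs m b ! (i - 1)))"

definition noise :: "nat \<Rightarrow> real \<Rightarrow> (nat \<Rightarrow> real) measure" where
  "noise n \<sigma> = PiM {..<n} (\<lambda>_. density lborel (normal_density 0 \<sigma>))"

definition num_selected :: "nat \<Rightarrow> (nat \<Rightarrow> real) \<Rightarrow> nat" where
  "num_selected m bh = card {i. i < m \<and> bh i \<noteq> 0}"

definition num_false :: "nat \<Rightarrow> (nat \<Rightarrow> real) \<Rightarrow> (nat \<Rightarrow> real) \<Rightarrow> nat" where
  "num_false m \<beta> bh = card {i. i < m \<and> \<beta> i = 0 \<and> bh i \<noteq> 0}"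

definition FDP :: "nat \<Rightarrow> (nat \<Rightarrow> real) \<Rightarrow> (nat \<Rightarrow> real) \<Rightarrow> real" where
  "FDP m \<beta> bh = real (num_false m \<beta> bh) / max (real (num_selected m bh)) 1"

end

theory Submission
  imports Defs
begin

text \<open>
  Moving a selected coefficient towards zero saves at least the weight \<open>\<lambda> R\<close> per unit, because the
  coefficient keeps one of the first \<open>R\<close> ranks; hence optimality forces \<open>\<bar>X\<^sub>j \<bullet> y\<bar> \<ge> \<sigma> \<lambda> R\<close> for every
  selected \<open>j\<close>, where \<open>R\<close> is the number of selected features. For a null \<open>j\<close> this is a statement about
  \<open>X\<^sub>j \<bullet> \<epsilon>\<close> only: its two-sided p-value is at most the level
  \<open>(\<lfloor>\<gamma>R\<rfloor> + 1) \<alpha> / (m + \<lfloor>\<gamma>R\<rfloor> + 1 - R)\<close> that defines \<open>\<lambda> R\<close>. When more than \<open>\<gamma>R\<close> of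
  the selected features are false, that level is at most \<open>V \<alpha> / N\<close>, with \<open>N\<close> the number of nulls and
  \<open>V\<close> the number of false selections. So some \<open>V\<close> of the \<open>N\<close> null p-values lie below \<open>V \<alpha> / N\<close>, which
  by the Simes inequality has probability at most \<open>\<alpha>\<close>. The null p-values are independent because
  orthonormal linear images of Gaussian noise are again Gaussian noise.
\<close>

section \<open>The standard normal distribution function\<close>

lemma Phi_eq_cdf: "Phi = cdf std_normal_distribution"
  by (simp add: Phi_def cdf_def fun_eq_iff)

text \<open>On the interval the density is at least its value at
  \<open>\<bar>a\<bar> + \<bar>b\<bar>\<close>, so the interval has positive mass. Strictness lets
  inequalities between values of \<open>Phi\<close> be pulled back to the arguments.\<close>

lemma Phi_strict_mono: "strict_mono Phi"
proof (rule strict_monoI)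
  interpret real_distribution std_normal_distribution by (rule real_dist_normal_dist)
  fix a b :: real assume "a < b"
  define c where "c = std_normal_density (\<bar>a\<bar> + \<bar>b\<bar>)"
  have c: "0 < c" by (simp add: c_def normal_density_pos)
  have low: "c \<le> std_normal_density x" if "a < x" "x \<le> b" for x
  proof -
    have "\<bar>x\<bar> \<le> \<bar>a\<bar> + \<bar>b\<bar>" using that by linarith
    then have "x\<^sup>2 \<le> (\<bar>a\<bar> + \<bar>b\<bar>)\<^sup>2" by (intro abs_le_square_iff[THEN iffD1]) auto
    then show ?thesis by (simp add: c_def std_normal_density_def divide_right_mono)
  qed
  have "ennreal (c * (b - a)) = (\<integral>\<^sup>+x. ennreal c * indicator {a<..b} x \<partial>lborel)"
    using \<open>a < b\<close> c by (simp add: nn_integral_cmult_indicator ennreal_mult)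
  also have "\<dots> \<le> (\<integral>\<^sup>+x. ennreal (std_normal_density x) * indicator {a<..b} x \<partial>lborel)"
    using low by (intro nn_integral_mono) (auto simp: indicator_def intro!: ennreal_leI)
  also have "\<dots> = emeasure std_normal_distribution {a<..b}"
    by (simp add: emeasure_density)
  finally have "ennreal (c * (b - a)) \<le> ennreal (Phi b - Phi a)"
    using \<open>a < b\<close> by (simp add: Phi_eq_cdf cdf_diff_eq emeasure_eq_measure)
  moreover have "0 < c * (b - a)" using c \<open>a < b\<close> by simp
  ultimately have "c * (b - a) \<le> Phi b - Phi a" by (simp add: ennreal_le_iff2)
  with \<open>0 < c * (b - a)\<close> show "Phi a < Phi b" by linarith
qed

lemma measure_normal_singleton:
  "measure (density lborel (normal_density \<mu> \<sigma>)) {x} = 0"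
proof -
  have "emeasure (density lborel (normal_density \<mu> \<sigma>)) {x} =
    (\<integral>\<^sup>+y. ennreal (normal_density \<mu> \<sigma> y) * indicator {x} y \<partial>lborel)"
    by (simp add: emeasure_density)
  also have "\<dots> = (\<integral>\<^sup>+(y::real). 0 \<partial>lborel)"
    by (intro nn_integral_cong_AE eventually_mono[OF AE_lborel_singleton[of x]]) (simp add: indicator_def)
  finally show ?thesis by (simp add: measure_def)
qed

lemma isCont_Phi: "isCont Phi x"
proof -
  interpret real_distribution std_normal_distribution by (rule real_dist_normal_dist)
  show ?thesis by (simp add: Phi_eq_cdf isCont_cdf measure_normal_singleton)
qed

text \<open>Continuity and the limits 0 and 1 give a preimage, strict monotonicity makes it unique,
  so the \<open>THE\<close> in \<open>Phi_inv\<close> denotes it.\<close>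

lemma Phi_Phi_inv:
  assumes "0 < p" "p < 1"
  shows "Phi (Phi_inv p) = p"
proof -
  interpret real_distribution std_normal_distribution by (rule real_dist_normal_dist)
  have "eventually (\<lambda>x. Phi x < p) at_bot"
    using order_tendstoD(2)[OF cdf_lim_at_bot] assms by (simp add: Phi_eq_cdf)
  then obtain a where a: "\<And>x. x \<le> a \<Longrightarrow> Phi x < p" by (auto simp: eventually_at_bot_linorder)
  have "eventually (\<lambda>x. p < Phi x) at_top"
    using order_tendstoD(1)[OF cdf_lim_at_top_prob] assms by (simp add: Phi_eq_cdf)
  then obtain b where b: "\<And>x. b \<le> x \<Longrightarrow> p < Phi x" by (auto simp: eventually_at_top_linorder)
  have "\<exists>x\<ge>min a b. x \<le> max a b \<and> Phi x = p"
    using a[of "min a b"] b[of "max a b"]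
    by (intro IVT) (auto simp: isCont_Phi)
  then obtain x where "Phi x = p" by blast
  then show ?thesis unfolding Phi_inv_def
    using strict_mono_eq[OF Phi_strict_mono] by (intro theI[of "\<lambda>x. Phi x = p" x]) auto
qed

section \<open>Symmetry, scaling and two-sided tails of centred normal laws\<close>

lemma distr_uminus_normal:
  "distr (density lborel (normal_density 0 \<sigma>)) borel uminus = density lborel (normal_density 0 \<sigma>)"
proof (rule measure_eqI)
  fix A assume "A \<in> sets (distr (density lborel (\<lambda>x. ennreal (normal_density 0 \<sigma> x))) borel uminus)"
  then have [measurable]: "A \<in> sets borel" by simp
  have "emeasure (distr (density lborel (normal_density 0 \<sigma>)) borel uminus) A =
    (\<integral>\<^sup>+x. ennreal (normal_density 0 \<sigma> x) * indicator A (- x) \<partial>lborel)"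
    by (simp add: emeasure_distr emeasure_density indicator_def vimage_def)
  also have "\<dots> = (\<integral>\<^sup>+x. ennreal (normal_density 0 \<sigma> (- x)) * indicator A x \<partial>lborel)"
    by (subst nn_integral_real_affine[where c="-1" and t=0]) auto
  finally show "emeasure (distr (density lborel (normal_density 0 \<sigma>)) borel uminus) A = emeasure (density lborel (normal_density 0 \<sigma>)) A"
    by (simp add: emeasure_density normal_density_def)
qed simp

lemma normal_cdf_eq_Phi:
  assumes "0 < \<sigma>"
  shows "measure (density lborel (normal_density 0 \<sigma>)) {..\<sigma> * x} = Phi x"
proof -
  have "emeasure (density lborel (normal_density 0 \<sigma>)) {..\<sigma> * x} =
    (\<integral>\<^sup>+y. ennreal (normal_density 0 \<sigma> y) * indicator {..\<sigma> * x} y \<partial>lborel)"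
    by (simp add: emeasure_density)
  also have "\<dots> = (\<integral>\<^sup>+y. ennreal \<sigma> * (ennreal (normal_density 0 \<sigma> (\<sigma> * y)) * indicator {..\<sigma> * x} (\<sigma> * y)) \<partial>lborel)"
    using assms by (subst nn_integral_real_affine[where c=\<sigma> and t=0]) (auto simp: nn_integral_cmult)
  also have "\<dots> = (\<integral>\<^sup>+y. ennreal (std_normal_density y) * indicator {..x} y \<partial>lborel)"
  proof (rule nn_integral_cong)
    fix y
    have "\<sigma> * normal_density 0 \<sigma> (\<sigma> * y) = std_normal_density y"
      using assms by (simp add: normal_density_def power_mult_distrib real_sqrt_mult field_simps)
    then show "ennreal \<sigma> * (ennreal (normal_density 0 \<sigma> (\<sigma> * y)) * indicator {..\<sigma> * x} (\<sigma> * y)) =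
      ennreal (std_normal_density y) * indicator {..x} y"
      using assms by (auto simp: indicator_def simp flip: ennreal_mult)
  qed
  also have "\<dots> = emeasure std_normal_distribution {..x}"
    by (simp add: emeasure_density)
  finally show ?thesis by (simp add: Phi_def measure_def)
qed

text \<open>A p-value of at most \<open>t\<close> forces \<open>\<bar>z\<bar>\<close> to reach
  \<open>\<sigma>\<close> times the quantile at \<open>1 - t / 2\<close>, and each of the two
  symmetric tails beyond that point has mass at most \<open>t / 2\<close>. This is the
  super-uniformity that the Simes inequality asks for.\<close>

lemma normal_two_sided_pvalue:
  assumes "0 < \<sigma>" "0 < t" "t < 1"
  shows "measure (density lborel (normal_density 0 \<sigma>)) {z. 2 * (1 - Phi (\<bar>z\<bar> / \<sigma>)) \<le> t} \<le> t"
proof -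
  let ?M = "density lborel (normal_density 0 \<sigma>)"
  interpret M: prob_space ?M using assms(1) by (rule prob_space_normal_density)
  define c where "c = Phi_inv (1 - t / 2)"
  have c: "Phi c = 1 - t / 2" unfolding c_def using assms by (intro Phi_Phi_inv) auto
  have sub: "{z. 2 * (1 - Phi (\<bar>z\<bar> / \<sigma>)) \<le> t} \<subseteq> {\<sigma> * c..} \<union> {..- (\<sigma> * c)}"
  proof
    fix z assume "z \<in> {z. 2 * (1 - Phi (\<bar>z\<bar> / \<sigma>)) \<le> t}"
    then have "Phi c \<le> Phi (\<bar>z\<bar> / \<sigma>)" by (simp add: c)
    then have "c \<le> \<bar>z\<bar> / \<sigma>" using strict_mono_less_eq[OF Phi_strict_mono] by simp
    then have "\<sigma> * c \<le> \<bar>z\<bar>" using assms(1) by (simp add: field_simps)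
    then show "z \<in> {\<sigma> * c..} \<union> {..- (\<sigma> * c)}" by auto
  qed
  \<comment> \<open>The complement of the half-line measured by the distribution function is an open
    tail; the missing endpoint carries no mass.\<close>
  have "{\<sigma> * c..} = insert (\<sigma> * c) (space ?M - {..\<sigma> * c})" by auto
  then have "measure ?M {\<sigma> * c..} \<le> measure ?M {\<sigma> * c} + measure ?M (space ?M - {..\<sigma> * c})"
    using measure_Un_le[of "{\<sigma> * c}" ?M "space ?M - {..\<sigma> * c}"] by (simp add: Compl_eq_Diff_UNIV[symmetric])
  also have "measure ?M (space ?M - {..\<sigma> * c}) = 1 - Phi c"
    by (subst M.prob_compl) (auto simp: normal_cdf_eq_Phi[OF assms(1)])
  finally have up: "measure ?M {\<sigma> * c..} \<le> t / 2" by (simp add: measure_normal_singleton c)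
  have "measure ?M {..- (\<sigma> * c)} = measure (distr ?M borel uminus) {..- (\<sigma> * c)}"
    by (simp add: distr_uminus_normal)
  also have "\<dots> = measure ?M {\<sigma> * c..}"
    by (subst measure_distr) (auto intro!: arg_cong[where f="measure ?M"])
  finally have "measure ?M {..- (\<sigma> * c)} \<le> t / 2" using up by simp
  with up have "measure ?M ({\<sigma> * c..} \<union> {..- (\<sigma> * c)}) \<le> t"
    using measure_Un_le[of "{\<sigma> * c..}" ?M "{..- (\<sigma> * c)}"] by simp
  moreover have "measure ?M {z. 2 * (1 - Phi (\<bar>z\<bar> / \<sigma>)) \<le> t} \<le> measure ?M ({\<sigma> * c..} \<union> {..- (\<sigma> * c)})"
    using sub by (rule M.finite_measure_mono) auto
  ultimately show ?thesis by linarith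
qed

section \<open>The FDP levels\<close>

text \<open>These are the Lehmann-Romano critical values for the false discovery proportion, read as
  two-sided levels: \<open>lambda_FDP\<close> cuts off an upper tail of half this mass.\<close>

definition FDP_level :: "nat \<Rightarrow> real \<Rightarrow> real \<Rightarrow> nat \<Rightarrow> real" where
  "FDP_level m \<alpha> \<gamma> i = (real (nat \<lfloor>\<gamma> * real i\<rfloor>) + 1) * \<alpha> / (real m + real (nat \<lfloor>\<gamma> * real i\<rfloor>) + 1 - real i)"

text \<open>The level is \<alpha> times a fraction \<open>f / (f + (m - i))\<close> in (0,1]. For
  \<alpha> < 1 this puts \<open>1 - FDP_level / 2\<close> inside (0,1), where \<open>Phi_inv\<close>
  is a genuine inverse.\<close>

lemma FDP_level_bounds:
  assumes "0 < \<alpha>" "i \<le> m"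
  shows "FDP_level m \<alpha> \<gamma> i \<in> {0<..\<alpha>}"
proof -
  define f where "f = real (nat \<lfloor>\<gamma> * real i\<rfloor>) + 1"
  have f: "0 < f" by (simp add: f_def)
  have i: "real i \<le> real m" using assms by simp
  have eq: "FDP_level m \<alpha> \<gamma> i = f * \<alpha> / (f + (real m - real i))"
    by (simp add: FDP_level_def f_def add_ac add_diff_eq)
  have "0 < FDP_level m \<alpha> \<gamma> i" unfolding eq using f i assms by simp
  moreover have "f * \<alpha> \<le> \<alpha> * (f + (real m - real i))" using f i assms by (simp add: algebra_simps mult_left_mono)
  then have "FDP_level m \<alpha> \<gamma> i \<le> \<alpha>" unfolding eq using f i by (simp add: pos_divide_le_eq)
  ultimately show ?thesis by simp
qed

text \<open>The fraction \<open>f / (f + g)\<close> grows with \<open>f\<close> and shrinks as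
  \<open>g\<close> grows; a larger rank raises \<open>f\<close> (the floor plus one) and lowers
  \<open>g = m - i\<close>, both weakly.\<close>

lemma FDP_level_mono:
  assumes "0 < \<alpha>" "0 \<le> \<gamma>" "i \<le> r" "r \<le> m"
  shows "FDP_level m \<alpha> \<gamma> i \<le> FDP_level m \<alpha> \<gamma> r"
proof -
  define f where "f k = real (nat \<lfloor>\<gamma> * real k\<rfloor>) + 1" for k
  have f: "0 < f k" for k by (simp add: f_def)
  have "\<gamma> * real i \<le> \<gamma> * real r" using assms by (simp add: mult_left_mono)
  then have "f i \<le> f r" by (simp add: f_def nat_mono floor_mono)
  then have le: "f i * (real m - real r) \<le> f r * (real m - real i)"
    using assms f[of r] by (intro mult_mono) auto
  have eq: "FDP_level m \<alpha> \<gamma> k = \<alpha> * (f k / (f k + (real m - real k)))" for k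
    by (simp add: FDP_level_def f_def algebra_simps)
  have pos: "0 < f i + (real m - real i)" "0 < f r + (real m - real r)"
    using f[of i] f[of r] assms by auto
  from le have "f i * (f r + (real m - real r)) \<le> f r * (f i + (real m - real i))"
    by (simp add: distrib_left mult.commute)
  then have "f i / (f i + (real m - real i)) \<le> f r / (f r + (real m - real r))"
    by (simp only: pos_divide_le_eq[OF pos(1)] times_divide_eq_left pos_le_divide_eq[OF pos(2)])
  then show ?thesis unfolding eq using assms(1) by (intro mult_left_mono) simp_all
qed

lemma lambda_FDP_eq: "lambda_FDP m \<alpha> \<gamma> i = Phi_inv (1 - FDP_level m \<alpha> \<gamma> i / 2)"
  by (simp add: lambda_FDP_def FDP_level_def mult.commute)

lemma Phi_lambda_FDP:
  assumes "0 < \<alpha>" "\<alpha> < 1" "i \<le> m"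
  shows "Phi (lambda_FDP m \<alpha> \<gamma> i) = 1 - FDP_level m \<alpha> \<gamma> i / 2"
  using FDP_level_bounds[OF assms(1,3), of \<gamma>] assms(2)
  by (simp add: lambda_FDP_eq Phi_Phi_inv)

text \<open>Consequently the weight at rank \<open>R\<close> is the smallest among the first
  \<open>R\<close> weights, which is what the shrinking argument for selected coefficients
  needs.\<close>

lemma lambda_FDP_antimono:
  assumes "0 < \<alpha>" "\<alpha> < 1" "0 \<le> \<gamma>" "i \<le> r" "r \<le> m"
  shows "lambda_FDP m \<alpha> \<gamma> r \<le> lambda_FDP m \<alpha> \<gamma> i"
proof -
  have "Phi (lambda_FDP m \<alpha> \<gamma> r) \<le> Phi (lambda_FDP m \<alpha> \<gamma> i)"
    using FDP_level_mono[OF assms(1,3-5)] assms by (simp add: Phi_lambda_FDP)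
  then show ?thesis using strict_mono_less_eq[OF Phi_strict_mono] by simp
qed

text \<open>At most \<open>m - R\<close> nulls are left unselected when \<open>R\<close> features are selected, so
  \<open>N - V \<le> m - R\<close>; with \<open>f = \<lfloor>\<gamma>R\<rfloor> + 1 \<le> V\<close> the claim reduces to \<open>0 \<le> (V - f)(N - V)\<close>.\<close>
lemma FDP_level_le_simes:
  assumes "0 < \<alpha>" "0 \<le> \<gamma>" and FDP: "\<gamma> < FDP m \<beta> b"
  defines "N \<equiv> card {j. j < m \<and> \<beta> j = 0}"
  shows "num_false m \<beta> b \<in> {1..N} \<and> num_selected m b \<in> {1..m} \<and>
    FDP_level m \<alpha> \<gamma> (num_selected m b) \<le> real (num_false m \<beta> b) * \<alpha> / N"
proof -
  define R where "R = num_selected m b"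
  define V where "V = num_false m \<beta> b"
  define f where "f = real (nat \<lfloor>\<gamma> * real R\<rfloor>) + 1"
  \<comment> \<open>The left side is nonnegative, so at least one false selection exists; then
    \<open>R\<close> is at least 1 as well and the maximum disappears.\<close>
  have FDPVR: "\<gamma> * max (real R) 1 < real V"
    using FDP by (simp add: FDP_def R_def V_def pos_less_divide_eq)
  moreover have "0 \<le> \<gamma> * max (real R) 1" using assms(2) by (intro mult_nonneg_nonneg) auto
  ultimately have "0 < real V" by linarith
  then have V1: "1 \<le> num_false m \<beta> b" by (simp add: V_def)
  have VN: "num_false m \<beta> b \<le> N"
    unfolding num_false_def N_def by (rule card_mono) auto
  have "V \<le> R" unfolding V_def R_def num_false_def num_selected_def by (rule card_mono) auto
  then have R1: "1 \<le> num_selected m b" using V1 by (simp add: R_def V_def)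
  have "num_selected m b \<le> card {..<m}" unfolding num_selected_def by (rule card_mono) auto
  then have Rm: "num_selected m b \<le> m" by simp
  have "R = V + card {i. i < m \<and> \<beta> i \<noteq> 0 \<and> b i \<noteq> 0}"
    unfolding R_def V_def num_false_def num_selected_def
    by (subst card_Un_disjoint[symmetric]) (auto intro: arg_cong[where f=card])
  moreover have "m = N + card {i. i < m \<and> \<beta> i \<noteq> 0}"
  proof -
    have "card {..<m} = card ({j. j < m \<and> \<beta> j = 0} \<union> {i. i < m \<and> \<beta> i \<noteq> 0})"
      by (rule arg_cong[where f=card]) auto
    then show ?thesis unfolding N_def by (subst (asm) card_Un_disjoint) auto
  qed
  moreover have "card {i. i < m \<and> \<beta> i \<noteq> 0 \<and> b i \<noteq> 0} \<le> card {i. i < m \<and> \<beta> i \<noteq> 0}"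
    by (rule card_mono) auto
  ultimately have "R + N \<le> m + V" by linarith
  then have left: "real N - real V \<le> real m - real R" by linarith
  have "\<gamma> * real R < real V" using FDPVR R1 by (simp add: R_def)
  \<comment> \<open>Integrality of \<open>V\<close> turns the strict bound into the floor plus one
    being at most \<open>V\<close>; the summand 1 in the level is matched exactly here.\<close>
  then have "\<lfloor>\<gamma> * real R\<rfloor> < int V" by (simp add: floor_less_iff)
  then have "nat \<lfloor>\<gamma> * real R\<rfloor> + 1 \<le> V" using V1 by (simp add: V_def)
  then have fV: "f \<le> real V" by (simp add: f_def)
  have f: "0 < f" by (simp add: f_def)
  have "0 \<le> (real V - f) * (real N - real V)" using fV VN by (simp add: V_def)
  then have "f * real N \<le> real V * (f + (real N - real V))" by (simp add: algebra_simps)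
  also have "\<dots> \<le> real V * (f + (real m - real R))" using left by (intro mult_left_mono) auto
  finally have "f * real N \<le> real V * (f + (real m - real R))" .
  from mult_left_mono[OF this, of \<alpha>]
  have "f * \<alpha> * real N \<le> real V * \<alpha> * (f + (real m - real R))"
    using assms(1) by (simp only: mult_ac less_imp_le)
  moreover have "0 < real N" using V1 VN by linarith
  moreover have "0 < f + (real m - real R)" using f Rm by (simp add: R_def)
  ultimately have "f * \<alpha> / (f + (real m - real R)) \<le> real V * \<alpha> / N"
    by (simp add: divide_le_eq le_divide_eq mult_ac)
  moreover have "FDP_level m \<alpha> \<gamma> R = f * \<alpha> / (f + (real m - real R))"
    by (simp add: FDP_level_def f_def add_ac add_diff_eq)
  ultimately show ?thesis using V1 VN R1 Rm by (simp add: R_def V_def)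
qed

section \<open>Selection thresholds of sorted L1 minimizers\<close>

text \<open>Lowering an inserted value moves it down the decreasing list. Each stretch of the
  descent between neighbouring entries is weighted by the rank occupied at that moment. The value
  stays positive, so it never sinks below the positive entries, and every rank it visits has weight
  at least \<open>c\<close>. The weights are arbitrary in the induction because passing one list
  entry shifts them by one.\<close>

lemma weighted_sum_insort_diff:
  fixes xs :: "real list" and \<mu> :: "nat \<Rightarrow> real"
  assumes "sorted (map uminus xs)" "0 < a'" "a' \<le> a"
    and "\<And>i. i \<le> length (filter (\<lambda>x. 0 < x) xs) \<Longrightarrow> c \<le> \<mu> i"
  shows "(\<Sum>i<Suc (length xs). \<mu> i * insort_key uminus a' xs ! i) + c * (a - a')
    \<le> (\<Sum>i<Suc (length xs). \<mu> i * insort_key uminus a xs ! i)"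
  using assms
proof (induction xs arbitrary: \<mu> a)
  case Nil
  then have "c * (a - a') \<le> \<mu> 0 * (a - a')" by (simp add: mult_right_mono)
  then show ?case by (simp add: algebra_simps)
next
  case (Cons x xs)
  have c0: "c \<le> \<mu> 0" using Cons.prems(4) by simp
  have srt: "sorted (map uminus xs)" using Cons.prems by simp
  consider "x \<le> a'" | "a' < x" "x \<le> a" | "a < x" by linarith
  then show ?case
  proof cases
    case 1
    then have "x \<le> a" using Cons.prems by simp
    moreover have "c * (a - a') \<le> \<mu> 0 * (a - a')" using c0 Cons.prems by (simp add: mult_right_mono)
    ultimately show ?thesis using 1
      by (simp add: sum.lessThan_Suc_shift algebra_simps del: sum.lessThan_Suc)
  next
    \<comment> \<open>The descent crosses \<open>x\<close>: the stretch from \<open>a\<close> to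
      \<open>x\<close> is paid at the front rank, and the rest is the induction hypothesis started
      from \<open>x\<close>, because inserting \<open>x\<close> into \<open>xs\<close> gives
      \<open>x # xs\<close>.\<close>
    case 2
    then have "0 < x" using Cons.prems by simp
    have "insort_key uminus x xs = x # xs"
      using Cons.prems(1) by (cases xs) auto
    with Cons.IH[of x "\<lambda>i. \<mu> (Suc i)"] srt Cons.prems \<open>0 < x\<close> 2
    have "(\<Sum>i<Suc (length xs). \<mu> (Suc i) * insort_key uminus a' xs ! i) + c * (x - a')
      \<le> (\<Sum>i<Suc (length xs). \<mu> (Suc i) * (x # xs) ! i)" by simp
    moreover have "c * (a - x) \<le> \<mu> 0 * (a - x)" using c0 2 by (simp add: mult_right_mono)
    ultimately show ?thesis using 2
      by (simp add: sum.lessThan_Suc_shift algebra_simps del: sum.lessThan_Suc)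
  next
    case 3
    then have "0 < x" using Cons.prems by simp
    with Cons.IH[of a "\<lambda>i. \<mu> (Suc i)"] srt Cons.prems 3
    have "(\<Sum>i<Suc (length xs). \<mu> (Suc i) * insort_key uminus a' xs ! i) + c * (a - a')
      \<le> (\<Sum>i<Suc (length xs). \<mu> (Suc i) * insort_key uminus a xs ! i)" by simp
    moreover have "\<not> x \<le> a'" "\<not> x \<le> a" using 3 Cons.prems by auto
    ultimately show ?thesis
      by (simp add: sum.lessThan_Suc_shift algebra_simps del: sum.lessThan_Suc)
  qed
qed

lemma rev_sort_eq_sort_key_uminus: "rev (sort (xs :: real list)) = sort_key uminus xs"
proof -
  have "sorted (map uminus (sort_key uminus xs))" by simp
  then have "sorted (rev (sort_key uminus xs))"
    by (simp add: sorted_wrt_rev sorted_map)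
  then have "sort xs = rev (sort_key uminus xs)"
    by (intro properties_for_sort) simp_all
  then show ?thesis by simp
qed

text \<open>Isolates coordinate \<open>j\<close>: the list that receives the insertion does not
  depend on \<open>b j\<close>. Both sides sort the same multiset by an injective key, so they
  coincide.\<close>

lemma sorted_abs_eq_insort:
  assumes "j < m"
  shows "sorted_abs m b =
    insort_key uminus \<bar>b j\<bar> (sort_key uminus (map (\<lambda>k. \<bar>b k\<bar>) (filter (\<lambda>k. k \<noteq> j) [0..<m])))"
proof -
  have "sort_key uminus (map (\<lambda>k. \<bar>b k\<bar>) [0..<m]) =
    sort_key uminus (\<bar>b j\<bar> # map (\<lambda>k. \<bar>b k\<bar>) (filter (\<lambda>k. k \<noteq> j) [0..<m]))"
  proof (rule sort_key_inj_key_eq)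
    have "mset [0..<m] = mset (j # filter (\<lambda>k. k \<noteq> j) [0..<m])"
      using assms by (intro set_eq_iff_mset_eq_distinct[THEN iffD1]) auto
    then have "mset (map (\<lambda>k. \<bar>b k\<bar>) [0..<m]) = mset (map (\<lambda>k. \<bar>b k\<bar>) (j # filter (\<lambda>k. k \<noteq> j) [0..<m]))"
      unfolding mset_map by (rule arg_cong)
    then show "mset (map (\<lambda>k. \<bar>b k\<bar>) [0..<m]) =
      mset (sort_key uminus (\<bar>b j\<bar> # map (\<lambda>k. \<bar>b k\<bar>) (filter (\<lambda>k. k \<noteq> j) [0..<m])))"
      unfolding mset_sort by simp
  qed (auto simp: sorted_insort_key)
  then show ?thesis by (simp add: sorted_abs_def rev_sort_eq_sort_key_uminus)
qed

text \<open>The shrunk coefficient keeps its sign and stays nonzero, so the number of selected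
  features is unchanged and the coefficient remains among that many first ranks, each weighted at
  least as much as the last of them.\<close>

lemma sorted_abs_penalty_shrink:
  fixes w :: "nat \<Rightarrow> real"
  assumes "j < m" "b j \<noteq> 0" "0 < a'" "a' \<le> \<bar>b j\<bar>"
    and mono: "\<And>i. 1 \<le> i \<Longrightarrow> i \<le> num_selected m b \<Longrightarrow> w (num_selected m b) \<le> w i"
  shows "(\<Sum>i=1..m. w i * sorted_abs m (b(j := sgn (b j) * a')) ! (i - 1)) + w (num_selected m b) * (\<bar>b j\<bar> - a')
    \<le> (\<Sum>i=1..m. w i * sorted_abs m b ! (i - 1))"
proof -
  define ks where "ks = filter (\<lambda>k. k \<noteq> j) [0..<m]"
  define xs where "xs = sort_key uminus (map (\<lambda>k. \<bar>b k\<bar>) ks)"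
  have len: "Suc (length xs) = m"
  proof -
    have "length ks = card (set ks)" by (intro distinct_card[symmetric]) (simp add: ks_def)
    also have "set ks = {..<m} - {j}" by (auto simp: ks_def)
    finally show ?thesis using assms(1) by (simp add: xs_def)
  qed
  \<comment> \<open>The successor accounts for \<open>j\<close> itself, which is selected but absent
    from \<open>xs\<close>.\<close>
  have sel: "Suc (length (filter (\<lambda>x. 0 < x) xs)) = num_selected m b"
  proof -
    have "length (filter (\<lambda>x. 0 < x) xs) = size (filter_mset (\<lambda>x. 0 < x) (mset xs))"
      by (metis mset_filter size_mset)
    also have "\<dots> = length (filter (\<lambda>x. 0 < x) (map (\<lambda>k. \<bar>b k\<bar>) ks))"
      by (metis mset_filter size_mset mset_sort xs_def)
    also have "\<dots> = length (filter (\<lambda>k. b k \<noteq> 0) ks)" by (simp add: filter_map o_def)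
    also have "\<dots> = card (set (filter (\<lambda>k. b k \<noteq> 0) ks))"
      by (intro distinct_card[symmetric]) (simp add: ks_def)
    also have "set (filter (\<lambda>k. b k \<noteq> 0) ks) = {i. i < m \<and> b i \<noteq> 0} - {j}" by (auto simp: ks_def)
    also have "Suc (card \<dots>) = card {i. i < m \<and> b i \<noteq> 0}"
      using assms(1,2) by (intro card_Suc_Diff1) auto
    finally show ?thesis by (simp add: num_selected_def)
  qed
  have a: "sorted_abs m b = insort_key uminus \<bar>b j\<bar> xs"
    using sorted_abs_eq_insort[OF assms(1)] by (simp add: xs_def ks_def)
  have "map (\<lambda>k. \<bar>(b(j := sgn (b j) * a')) k\<bar>) ks = map (\<lambda>k. \<bar>b k\<bar>) ks"
    by (simp add: ks_def)
  moreover have "\<bar>sgn (b j) * a'\<bar> = a'" using assms by (simp add: abs_mult)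
  ultimately have a': "sorted_abs m (b(j := sgn (b j) * a')) = insort_key uminus a' xs"
    using sorted_abs_eq_insort[OF assms(1), of "b(j := sgn (b j) * a')"]
    unfolding ks_def[symmetric] by (simp only: xs_def fun_upd_same)
  have shift: "(\<Sum>i=1..m. w i * L ! (i - 1)) = (\<Sum>i<m. w (Suc i) * L ! i)" for L
    by (rule sum.reindex_bij_witness[of _ Suc "\<lambda>i. i - 1"]) auto
  have "(\<Sum>i<Suc (length xs). w (Suc i) * insort_key uminus a' xs ! i) + w (num_selected m b) * (\<bar>b j\<bar> - a')
    \<le> (\<Sum>i<Suc (length xs). w (Suc i) * insort_key uminus \<bar>b j\<bar> xs ! i)"
  proof (rule weighted_sum_insort_diff)
    show "w (num_selected m b) \<le> w (Suc i)" if "i \<le> length (filter (\<lambda>x. 0 < x) xs)" for i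
      by (rule mono) (use that sel in auto)
  qed (simp_all add: xs_def assms(3,4))
  then show ?thesis unfolding shift a a' len .
qed

section \<open>From perturbing one coefficient to the selection threshold\<close>

text \<open>Lowering \<open>b j\<close> by \<open>d\<close> adds \<open>d\<close> times column
  \<open>j\<close> to the residual. By orthonormality that column has norm one and its inner product
  with the old residual involves no other coefficient.\<close>

lemma fslope_residual_update:
  fixes X :: "nat \<Rightarrow> nat \<Rightarrow> real"
  assumes orth: "\<forall>j<m. \<forall>k<m. (\<Sum>i<n. X i j * X i k) = (if j = k then 1 else 0)"
    and j: "j < m"
  shows "(\<Sum>i<n. (y i - (\<Sum>k<m. X i k * (b(j := b j - d)) k))\<^sup>2) =
    (\<Sum>i<n. (y i - (\<Sum>k<m. X i k * b k))\<^sup>2) + 2 * d * ((\<Sum>i<n. X i j * y i) - b j) + d\<^sup>2"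
proof -
  define r where "r i = y i - (\<Sum>k<m. X i k * b k)" for i
  have upd: "(\<Sum>k<m. X i k * (b(j := b j - d)) k) = (\<Sum>k<m. X i k * b k) - d * X i j" for i
  proof -
    have "(\<Sum>k<m. X i k * (b(j := b j - d)) k) = (\<Sum>k<m. X i k * b k - (if k = j then d * X i j else 0))"
      by (intro sum.cong) (auto simp: algebra_simps)
    also have "\<dots> = (\<Sum>k<m. X i k * b k) - d * X i j"
      using j by (subst sum_subtractf, subst sum.delta) auto
    finally show ?thesis .
  qed
  have "(\<Sum>i<n. X i j * r i) = (\<Sum>i<n. X i j * y i) - (\<Sum>i<n. \<Sum>k<m. X i j * X i k * b k)"
    by (simp add: r_def right_diff_distrib sum_subtractf sum_distrib_left mult.assoc)
  also have "(\<Sum>i<n. \<Sum>k<m. X i j * X i k * b k) = (\<Sum>k<m. (\<Sum>i<n. X i j * X i k) * b k)"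
    by (subst sum.swap) (simp add: sum_distrib_right)
  also have "\<dots> = (\<Sum>k<m. if j = k then b k else 0)"
    using orth j by (intro sum.cong) auto
  also have "\<dots> = b j" using j by simp
  finally have cross: "(\<Sum>i<n. X i j * r i) = (\<Sum>i<n. X i j * y i) - b j" .
  have "(\<Sum>i<n. (r i + d * X i j)\<^sup>2) = (\<Sum>i<n. (r i)\<^sup>2) + 2 * d * (\<Sum>i<n. X i j * r i) + d\<^sup>2 * (\<Sum>i<n. X i j * X i j)"
    by (simp add: power2_eq_square algebra_simps sum.distrib sum_distrib_left)
  moreover have "(\<Sum>i<n. X i j * X i j) = 1" using orth j by auto
  moreover have "y i - (\<Sum>k<m. X i k * (b(j := b j - d)) k) = r i + d * X i j" for i
    unfolding upd r_def by simp
  ultimately show ?thesis by (simp only: cross mult_1_right flip: r_def)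
qed

text \<open>Shrinking \<open>b j\<close> by \<open>t\<close> saves at least
  \<open>\<sigma> * c * t\<close> of penalty, where \<open>c\<close> is the weight at the rank given
  by the number of selected features. Minimality says that the quadratic part must rise by at least
  as much.\<close>

lemma fslope_selected_threshold:
  fixes X :: "nat \<Rightarrow> nat \<Rightarrow> real"
  assumes orth: "\<forall>j<m. \<forall>k<m. (\<Sum>i<n. X i j * X i k) = (if j = k then 1 else 0)"
    and "0 \<le> \<sigma>" and j: "j < m" "b j \<noteq> 0"
    and mono: "\<And>i. 1 \<le> i \<Longrightarrow> i \<le> num_selected m b \<Longrightarrow>
      lambda_FDP m \<alpha> \<gamma> (num_selected m b) \<le> lambda_FDP m \<alpha> \<gamma> i"
    and min: "\<And>b'. fslope_obj n m X \<sigma> \<alpha> \<gamma> y b \<le> fslope_obj n m X \<sigma> \<alpha> \<gamma> y b'"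
  shows "\<sigma> * lambda_FDP m \<alpha> \<gamma> (num_selected m b) \<le> \<bar>\<Sum>i<n. X i j * y i\<bar>"
proof -
  \<comment> \<open>Any step below \<open>\<bar>b j\<bar>\<close> keeps the coefficient nonzero.
    With half of it the second-order term \<open>t / 2\<close> is absorbed by
    \<open>- \<bar>b j\<bar>\<close>, so no limit of small steps is required.\<close>
  define t where "t = \<bar>b j\<bar> / 2"
  define c where "c = lambda_FDP m \<alpha> \<gamma> (num_selected m b)"
  define w where "w = (\<Sum>i<n. X i j * y i)"
  define P where "P b' = (\<Sum>i=1..m. lambda_FDP m \<alpha> \<gamma> i * sorted_abs m b' ! (i - 1))" for b'
  have t: "0 < t" "t < \<bar>b j\<bar>" using j by (auto simp: t_def)
  have eq: "b j - sgn (b j) * t = sgn (b j) * (\<bar>b j\<bar> - t)"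
    by (simp add: right_diff_distrib sgn_mult_abs)
  have "0 < \<bar>b j\<bar> - t" "\<bar>b j\<bar> - t \<le> \<bar>b j\<bar>" using t by auto
  from sorted_abs_penalty_shrink[where w="lambda_FDP m \<alpha> \<gamma>", OF j this mono]
  have "P (b(j := b j - sgn (b j) * t)) + c * t \<le> P b"
    by (simp add: P_def c_def eq)
  then have P: "\<sigma> * P (b(j := b j - sgn (b j) * t)) + \<sigma> * (c * t) \<le> \<sigma> * P b"
    by (metis assms(2) mult_left_mono distrib_left)
  have "(sgn (b j) * t)\<^sup>2 = t\<^sup>2" using j by (simp add: power_mult_distrib power2_eq_square sgn_if)
  then have "\<sigma> * P b \<le> sgn (b j) * t * (w - b j) + t\<^sup>2 / 2 + \<sigma> * P (b(j := b j - sgn (b j) * t))"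
    using min[of "b(j := b j - sgn (b j) * t)"]
    unfolding fslope_obj_def P_def[symmetric] fslope_residual_update[OF orth j(1)] w_def[symmetric]
    by (simp add: add_divide_distrib)
  with P have "\<sigma> * (c * t) \<le> sgn (b j) * t * (w - b j) + t\<^sup>2 / 2"
    by linarith
  also have "\<dots> = t * (sgn (b j) * w - \<bar>b j\<bar> + t / 2)"
    by (simp add: power2_eq_square field_simps abs_sgn mult.commute)
  finally have "t * (\<sigma> * c) \<le> t * (sgn (b j) * w - \<bar>b j\<bar> + t / 2)" by (simp add: mult_ac)
  then have "\<sigma> * c \<le> sgn (b j) * w - \<bar>b j\<bar> + t / 2" using t by simp
  also have "\<dots> \<le> \<bar>w\<bar>" using t by (auto simp: sgn_if)
  finally show ?thesis by (simp add: c_def w_def)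
qed

section \<open>Orthonormal images of Gaussian noise\<close>

lemma nn_integral_lborel_translate:
  assumes [measurable]: "f \<in> borel_measurable borel"
  shows "(\<integral>\<^sup>+x. f (x + t) \<partial>lborel) = (\<integral>\<^sup>+x. f (x::real) \<partial>lborel)"
  by (subst (2) nn_integral_real_affine[where c=1 and t=t]) (auto simp: add.commute)

text \<open>With the first coordinate fixed, the shear is a translation of the second, so Tonelli
  reduces the claim to translation invariance.\<close>

lemma nn_integral_shear_snd:
  fixes g :: "real \<times> real \<Rightarrow> ennreal"
  assumes [measurable]: "g \<in> borel_measurable (borel \<Otimes>\<^sub>M borel)"
  shows "(\<integral>\<^sup>+p. g (fst p, snd p + t * fst p) \<partial>(lborel \<Otimes>\<^sub>M lborel)) = (\<integral>\<^sup>+p. g p \<partial>(lborel \<Otimes>\<^sub>M lborel))"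
proof -
  have [measurable]: "g \<in> borel_measurable (lborel \<Otimes>\<^sub>M lborel)" by simp
  have "(\<integral>\<^sup>+p. g (fst p, snd p + t * fst p) \<partial>(lborel \<Otimes>\<^sub>M lborel)) = (\<integral>\<^sup>+x. \<integral>\<^sup>+y. g (x, y + t * x) \<partial>lborel \<partial>lborel)"
    by (subst lborel.nn_integral_fst[symmetric]) auto
  also have "\<dots> = (\<integral>\<^sup>+x. \<integral>\<^sup>+y. g (x, y) \<partial>lborel \<partial>lborel)"
    by (intro nn_integral_cong nn_integral_lborel_translate) measurable
  also have "\<dots> = (\<integral>\<^sup>+p. g p \<partial>(lborel \<Otimes>\<^sub>M lborel))"
    by (subst lborel.nn_integral_fst) auto
  finally show ?thesis .
qed

lemma nn_integral_shear_fst: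
  fixes g :: "real \<times> real \<Rightarrow> ennreal"
  assumes [measurable]: "g \<in> borel_measurable (borel \<Otimes>\<^sub>M borel)"
  shows "(\<integral>\<^sup>+p. g (fst p + t * snd p, snd p) \<partial>(lborel \<Otimes>\<^sub>M lborel)) = (\<integral>\<^sup>+p. g p \<partial>(lborel \<Otimes>\<^sub>M lborel))"
proof -
  have [measurable]: "g \<in> borel_measurable (lborel \<Otimes>\<^sub>M lborel)" by simp
  have "(\<integral>\<^sup>+p. g (fst p + t * snd p, snd p) \<partial>(lborel \<Otimes>\<^sub>M lborel)) = (\<integral>\<^sup>+y. \<integral>\<^sup>+x. g (x + t * y, y) \<partial>lborel \<partial>lborel)"
    by (subst lborel_pair.nn_integral_snd[symmetric]) (auto simp: split_beta')
  also have "\<dots> = (\<integral>\<^sup>+y. \<integral>\<^sup>+x. g (x, y) \<partial>lborel \<partial>lborel)"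
    by (intro nn_integral_cong nn_integral_lborel_translate) measurable
  also have "\<dots> = (\<integral>\<^sup>+p. g p \<partial>(lborel \<Otimes>\<^sub>M lborel))"
    by (subst lborel_pair.nn_integral_snd[symmetric]) (auto simp: split_beta')
  finally show ?thesis .
qed

text \<open>A plane rotation by an angle with nonzero sine is a product of three shears.\<close>
lemma nn_integral_lborel_rotation:
  fixes g :: "real \<times> real \<Rightarrow> ennreal"
  assumes [measurable]: "g \<in> borel_measurable (borel \<Otimes>\<^sub>M borel)"
    and cs: "c\<^sup>2 + s\<^sup>2 = 1" "s \<noteq> 0"
  shows "(\<integral>\<^sup>+p. g (c * fst p - s * snd p, s * fst p + c * snd p) \<partial>(lborel \<Otimes>\<^sub>M lborel)) = (\<integral>\<^sup>+p. g p \<partial>(lborel \<Otimes>\<^sub>M lborel))"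
proof -
  \<comment> \<open>For an angle with cosine \<open>c\<close> and sine \<open>s\<close> this is
    minus the tangent of the half angle; the shears have parameters \<open>t\<close>,
    \<open>s\<close>, \<open>t\<close>.\<close>
  define t where "t = (c - 1) / s"
  have st: "s * t = c - 1" using cs by (simp add: t_def)
  have "s * (t + t * c) = c\<^sup>2 - 1" by (simp add: distrib_left st flip: mult.assoc) (simp add: algebra_simps power2_eq_square)
  also have "\<dots> = s * (- s)" using cs by (simp add: power2_eq_square algebra_simps)
  finally have tc: "t + t * c = - s" using cs by (metis mult_left_cancel)
  define g1 where "g1 = (\<lambda>p. g (fst p + t * snd p, snd p))"
  define g2 where "g2 = (\<lambda>p. g1 (fst p, snd p + s * fst p))"
  have [measurable]: "g1 \<in> borel_measurable (borel \<Otimes>\<^sub>M borel)" unfolding g1_def by measurable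
  have [measurable]: "g2 \<in> borel_measurable (borel \<Otimes>\<^sub>M borel)" unfolding g2_def by measurable
  have "g (c * x - s * y, s * x + c * y) = g2 (x + t * y, y)" for x y
  proof -
    have "s * (x + t * y) + y = s * x + (s * t + 1) * y" by (simp add: algebra_simps)
    then have "s * (x + t * y) + y = s * x + c * y" by (simp add: st)
    moreover have "x + t * y + t * (s * x + c * y) = c * x - s * y"
    proof -
      have "x + t * y + t * (s * x + c * y) = (1 + s * t) * x + (t + t * c) * y" by (simp add: algebra_simps)
      then show ?thesis by (simp add: st tc)
    qed
    ultimately show ?thesis by (simp add: g1_def g2_def add.commute)
  qed
  then have "(\<integral>\<^sup>+p. g (c * fst p - s * snd p, s * fst p + c * snd p) \<partial>(lborel \<Otimes>\<^sub>M lborel)) =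
    (\<integral>\<^sup>+p. g2 (fst p + t * snd p, snd p) \<partial>(lborel \<Otimes>\<^sub>M lborel))" by simp
  also have "\<dots> = (\<integral>\<^sup>+p. g2 p \<partial>(lborel \<Otimes>\<^sub>M lborel))" by (rule nn_integral_shear_fst) measurable
  also have "\<dots> = (\<integral>\<^sup>+p. g1 p \<partial>(lborel \<Otimes>\<^sub>M lborel))" unfolding g2_def by (rule nn_integral_shear_snd) measurable
  also have "\<dots> = (\<integral>\<^sup>+p. g p \<partial>(lborel \<Otimes>\<^sub>M lborel))" unfolding g1_def by (rule nn_integral_shear_fst) measurable
  finally show ?thesis .
qed

section \<open>Gaussian laws under rotations and orthonormal maps\<close>

text \<open>The product density depends only on the sum of squares of the coordinates, so it is
  unchanged by the rotation and can be carried along inside the Lebesgue integral.\<close>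

lemma nn_integral_normal_rotation:
  fixes f :: "real \<Rightarrow> real \<Rightarrow> ennreal" and \<sigma> :: real
  defines "G \<equiv> density lborel (normal_density 0 \<sigma>)"
  assumes f: "case_prod f \<in> borel_measurable (borel \<Otimes>\<^sub>M borel)"
    and cs: "c\<^sup>2 + s\<^sup>2 = 1" "s \<noteq> 0"
  shows "(\<integral>\<^sup>+x. \<integral>\<^sup>+y. f (c * x - s * y) (s * x + c * y) \<partial>G \<partial>G) = (\<integral>\<^sup>+x. \<integral>\<^sup>+y. f x y \<partial>G \<partial>G)"
proof -
  note f [measurable]
  define D where "D p = ennreal (normal_density 0 \<sigma> (fst p)) * ennreal (normal_density 0 \<sigma> (snd p))" for p
  have [measurable]: "D \<in> borel_measurable (borel \<Otimes>\<^sub>M borel)" unfolding D_def by measurable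
  have rot: "D (c * x - s * y, s * x + c * y) = D (x, y)" for x y
  proof -
    have "(c * x - s * y)\<^sup>2 + (s * x + c * y)\<^sup>2 = (c\<^sup>2 + s\<^sup>2) * (x\<^sup>2 + y\<^sup>2)"
      by (simp add: power2_eq_square algebra_simps)
    then have sq: "(c * x - s * y)\<^sup>2 + (s * x + c * y)\<^sup>2 = x\<^sup>2 + y\<^sup>2" using cs by simp
    have D: "D (a, b) = ennreal ((1 / sqrt (2 * pi * \<sigma>\<^sup>2))\<^sup>2 * exp (- (a\<^sup>2 + b\<^sup>2) / (2 * \<sigma>\<^sup>2)))" for a b
      unfolding D_def normal_density_def
      by (simp add: power2_eq_square add_divide_distrib exp_add mult_ac flip: ennreal_mult)
         (simp add: diff_divide_distrib exp_diff exp_minus field_simps)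
    show ?thesis by (simp add: D sq)
  qed
  have iter: "(\<integral>\<^sup>+x. \<integral>\<^sup>+y. h x y \<partial>G \<partial>G) = (\<integral>\<^sup>+p. D p * h (fst p) (snd p) \<partial>(lborel \<Otimes>\<^sub>M lborel))"
    if [measurable]: "case_prod h \<in> borel_measurable (borel \<Otimes>\<^sub>M borel)" for h
  proof -
    have [measurable]: "case_prod h \<in> borel_measurable (borel \<Otimes>\<^sub>M lborel)" by simp
    have [measurable]: "D \<in> borel_measurable (borel \<Otimes>\<^sub>M lborel)" by simp
    have "(\<integral>\<^sup>+x. \<integral>\<^sup>+y. h x y \<partial>G \<partial>G) =
      (\<integral>\<^sup>+x. ennreal (normal_density 0 \<sigma> x) * (\<integral>\<^sup>+y. ennreal (normal_density 0 \<sigma> y) * h x y \<partial>lborel) \<partial>lborel)"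
      unfolding G_def by (simp add: nn_integral_density)
    also have "\<dots> = (\<integral>\<^sup>+x. \<integral>\<^sup>+y. D (x, y) * h x y \<partial>lborel \<partial>lborel)"
      by (simp add: D_def nn_integral_cmult mult.assoc)
    also have "\<dots> = (\<integral>\<^sup>+p. D p * h (fst p) (snd p) \<partial>(lborel \<Otimes>\<^sub>M lborel))"
      by (subst lborel.nn_integral_fst[symmetric]) auto
    finally show ?thesis .
  qed
  have "(\<integral>\<^sup>+x. \<integral>\<^sup>+y. f (c * x - s * y) (s * x + c * y) \<partial>G \<partial>G) =
    (\<integral>\<^sup>+p. D p * f (c * fst p - s * snd p) (s * fst p + c * snd p) \<partial>(lborel \<Otimes>\<^sub>M lborel))"
    by (rule iter) measurable
  also have "\<dots> = (\<integral>\<^sup>+p. (\<lambda>q. D q * f (fst q) (snd q)) (c * fst p - s * snd p, s * fst p + c * snd p) \<partial>(lborel \<Otimes>\<^sub>M lborel))"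
    by (simp add: rot)
  also have "\<dots> = (\<integral>\<^sup>+p. D p * f (fst p) (snd p) \<partial>(lborel \<Otimes>\<^sub>M lborel))"
    by (rule nn_integral_lborel_rotation) (use cs in measurable)
  also have "\<dots> = (\<integral>\<^sup>+x. \<integral>\<^sup>+y. f x y \<partial>G \<partial>G)"
    by (rule iter[symmetric]) measurable
  finally show ?thesis .
qed

text \<open>Tonelli splits off coordinates \<open>i1\<close> and \<open>i2\<close>; for frozen
  remaining coordinates the planar case applies.\<close>

lemma nn_integral_PiM_normal_rotation:
  fixes \<sigma> :: real
  defines "G \<equiv> density lborel (normal_density 0 \<sigma>)"
  assumes "0 < \<sigma>" "finite I" and i: "i1 \<in> I" "i2 \<in> I" "i1 \<noteq> i2"
    and f: "f \<in> borel_measurable (PiM I (\<lambda>_. G))"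
    and cs: "c\<^sup>2 + s\<^sup>2 = 1" "s \<noteq> 0"
  shows "(\<integral>\<^sup>+x. f (x(i1 := c * x i1 - s * x i2, i2 := s * x i1 + c * x i2)) \<partial>PiM I (\<lambda>_. G)) =
    (\<integral>\<^sup>+x. f x \<partial>PiM I (\<lambda>_. G))"
proof -
  interpret G: prob_space G unfolding G_def using assms(2) by (rule prob_space_normal_density)
  interpret product_sigma_finite "\<lambda>_. G" ..
  have [measurable_cong]: "sets G = sets borel" by (simp add: G_def)
  define I' where "I' = I - {i1, i2}"
  have I: "I = insert i1 (insert i2 I')" "i2 \<notin> I'" "i1 \<notin> insert i2 I'" "finite I'"
    using i assms(3) by (auto simp: I'_def)
  have iter: "(\<integral>\<^sup>+x. h x \<partial>PiM I (\<lambda>_. G)) =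
    (\<integral>\<^sup>+x. \<integral>\<^sup>+z. \<integral>\<^sup>+y. h (x(i2 := z, i1 := y)) \<partial>G \<partial>G \<partial>PiM I' (\<lambda>_. G))"
    if "h \<in> borel_measurable (PiM I (\<lambda>_. G))" for h :: "_ \<Rightarrow> ennreal"
  proof -
    have [measurable]: "h \<in> borel_measurable (PiM (insert i1 (insert i2 I')) (\<lambda>_. G))"
      using that I(1) by simp
    have "(\<integral>\<^sup>+x. h x \<partial>PiM I (\<lambda>_. G)) =
      (\<integral>\<^sup>+x. \<integral>\<^sup>+y. h (x(i1 := y)) \<partial>G \<partial>PiM (insert i2 I') (\<lambda>_. G))"
      unfolding I(1) using I by (subst product_nn_integral_insert) auto
    also have "\<dots> = (\<integral>\<^sup>+x. \<integral>\<^sup>+z. \<integral>\<^sup>+y. h (x(i2 := z, i1 := y)) \<partial>G \<partial>G \<partial>PiM I' (\<lambda>_. G))"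
      using I by (subst product_nn_integral_insert) auto
    finally show ?thesis .
  qed
  have rot: "(\<lambda>x. x(i1 := c * x i1 - s * x i2, i2 := s * x i1 + c * x i2)) \<in>
    measurable (PiM I (\<lambda>_. G)) (PiM I (\<lambda>_. G))"
  proof (rule measurable_PiM_single')
    fix i assume "i \<in> I"
    then show "(\<lambda>x. (x(i1 := c * x i1 - s * x i2, i2 := s * x i1 + c * x i2)) i) \<in> measurable (PiM I (\<lambda>_. G)) G"
      using i by (cases "i = i1"; cases "i = i2") simp_all
  qed (use i in \<open>auto simp: space_PiM PiE_def extensional_def G_def\<close>)
  \<comment> \<open>The outer of the two split integrals runs over coordinate \<open>i2\<close>. In
    the order (\<open>i2\<close>, \<open>i1\<close>) the rotation runs in the opposite sense, hence
    the sine \<open>- s\<close>.\<close>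
  have "(\<integral>\<^sup>+x. f (x(i1 := c * x i1 - s * x i2, i2 := s * x i1 + c * x i2)) \<partial>PiM I (\<lambda>_. G)) =
    (\<integral>\<^sup>+x. \<integral>\<^sup>+z. \<integral>\<^sup>+y. f (x(i2 := c * z - (- s) * y, i1 := (- s) * z + c * y)) \<partial>G \<partial>G \<partial>PiM I' (\<lambda>_. G))"
    using i by (subst iter[OF measurable_compose[OF rot f]])
      (simp add: fun_upd_twist algebra_simps)
  also have "\<dots> = (\<integral>\<^sup>+x. \<integral>\<^sup>+z. \<integral>\<^sup>+y. f (x(i2 := z, i1 := y)) \<partial>G \<partial>G \<partial>PiM I' (\<lambda>_. G))"
  proof (rule nn_integral_cong)
    fix x assume x: "x \<in> space (PiM I' (\<lambda>_. G))"
    have "(\<lambda>p. x(i2 := fst p, i1 := snd p)) \<in> measurable (borel \<Otimes>\<^sub>M borel) (PiM I (\<lambda>_. G))"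
    proof (rule measurable_PiM_single')
      fix i assume "i \<in> I"
      then show "(\<lambda>p. (x(i2 := fst p, i1 := snd p)) i) \<in> measurable (borel \<Otimes>\<^sub>M borel) G"
        by (cases "i = i1"; cases "i = i2") (auto simp: G_def intro!: measurable_const)
    qed (use x I in \<open>auto simp: space_PiM PiE_def extensional_def G_def\<close>)
    from measurable_compose[OF this f]
    have "(\<lambda>(z, y). f (x(i2 := z, i1 := y))) \<in> borel_measurable (borel \<Otimes>\<^sub>M borel)"
      by (simp add: split_beta')
    then show "(\<integral>\<^sup>+z. \<integral>\<^sup>+y. f (x(i2 := c * z - (- s) * y, i1 := (- s) * z + c * y)) \<partial>G \<partial>G) =
      (\<integral>\<^sup>+z. \<integral>\<^sup>+y. f (x(i2 := z, i1 := y)) \<partial>G \<partial>G)"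
      unfolding G_def using cs
      by (intro nn_integral_normal_rotation[where f="\<lambda>z y. f (x(i2 := z, i1 := y))"]) auto
  qed
  also have "\<dots> = (\<integral>\<^sup>+x. f x \<partial>PiM I (\<lambda>_. G))" using iter[OF f] by simp
  finally show ?thesis .
qed

text \<open>Plane rotations of the input coordinates clear the entries of one row until a single entry
  \<open>\<plusminus>1\<close> remains; orthogonality then makes that input coordinate absent from all other rows.\<close>
lemma nn_integral_orthonormal_image_normal:
  fixes A :: "'j \<Rightarrow> 'i \<Rightarrow> real" and \<sigma> :: real
  defines "G \<equiv> density lborel (normal_density 0 \<sigma>)"
  assumes "0 < \<sigma>" "finite J" "finite I"
    and "\<And>j k. j \<in> J \<Longrightarrow> k \<in> J \<Longrightarrow> (\<Sum>i\<in>I. A j i * A k i) = (if j = k then 1 else 0)"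
    and "f \<in> borel_measurable (PiM J (\<lambda>_. G))"
  shows "(\<integral>\<^sup>+x. f (\<lambda>j\<in>J. \<Sum>i\<in>I. A j i * x i) \<partial>PiM I (\<lambda>_. G)) = (\<integral>\<^sup>+x. f x \<partial>PiM J (\<lambda>_. G))"
  using assms(3-)
proof (induction J arbitrary: I A f rule: finite_induct)
  interpret G: prob_space G unfolding G_def using assms(2) by (rule prob_space_normal_density)
  case (empty I A f)
  interpret P: prob_space "PiM I (\<lambda>_. G)" by (intro prob_space_PiM G.prob_space_axioms)
  show ?case by (simp add: P.emeasure_space_1 PiM_empty nn_integral_count_space_finite)
next
  interpret G: prob_space G unfolding G_def using assms(2) by (rule prob_space_normal_density)
  interpret PI: product_sigma_finite "\<lambda>_::'i. G" ..
  interpret PJ: product_sigma_finite "\<lambda>_::'j. G" ..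
  have [measurable_cong]: "sets G = sets borel" by (simp add: G_def)
  case (insert j J I A f)
  note f = insert.prems(3)
  \<comment> \<open>For a fixed index set the matrix is generalized, so that an inner induction can
    reduce the number of nonzero entries in row \<open>j\<close>.\<close>
  have "(\<integral>\<^sup>+x. f (\<lambda>k\<in>insert j J. \<Sum>i\<in>I. B k i * x i) \<partial>PiM I (\<lambda>_. G)) =
    (\<integral>\<^sup>+x. f x \<partial>PiM (insert j J) (\<lambda>_. G))"
    if "\<And>k l. k \<in> insert j J \<Longrightarrow> l \<in> insert j J \<Longrightarrow> (\<Sum>i\<in>I. B k i * B l i) = (if k = l then 1 else 0)" for B
    using that
  proof (induction "card {i\<in>I. B j i \<noteq> 0}" arbitrary: B rule: less_induct)
    case less
    define S where "S = {i\<in>I. B j i \<noteq> 0}"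
    have S: "finite S" using \<open>finite I\<close> by (simp add: S_def)
    have norm: "(\<Sum>i\<in>I. B j i * B j i) = 1" using less.prems[of j j] by simp
    then have "S \<noteq> {}" by (force simp: S_def intro: sum.neutral)
    then obtain i1 where i1: "i1 \<in> I" "B j i1 \<noteq> 0" by (auto simp: S_def)
    have map_meas: "(\<lambda>x. f (\<lambda>k\<in>insert j J. \<Sum>i\<in>I. B k i * x i)) \<in> borel_measurable (PiM I (\<lambda>_. G))"
      using f by measurable
    show ?case
    proof (cases "\<exists>i2\<in>S. i2 \<noteq> i1")
      case True
      then obtain i2 where i2: "i2 \<in> I" "B j i2 \<noteq> 0" "i1 \<noteq> i2" by (auto simp: S_def)
      define r where "r = sqrt ((B j i1)\<^sup>2 + (B j i2)\<^sup>2)"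
      have r: "r \<noteq> 0" "r\<^sup>2 = (B j i1)\<^sup>2 + (B j i2)\<^sup>2"
        using i1 i2 by (auto simp: r_def sum_power2_eq_zero_iff)
      \<comment> \<open>The unit vector along the two chosen entries of row \<open>j\<close>:
        rotating by it moves their joint length \<open>r\<close> into position \<open>i1\<close> and
        leaves 0 at \<open>i2\<close>.\<close>
      define c where "c = B j i1 / r"
      define s where "s = B j i2 / r"
      have cs: "c\<^sup>2 + s\<^sup>2 = 1" "s \<noteq> 0"
        using r i2 by (auto simp: c_def s_def power_divide simp flip: add_divide_distrib)
      define B' where "B' k = (B k)(i1 := c * B k i1 + s * B k i2, i2 := c * B k i2 - s * B k i1)" for k
      have split: "(\<Sum>i\<in>I. g i) = g i1 + g i2 + (\<Sum>i\<in>I - {i1, i2}. g i)" for g :: "'i \<Rightarrow> real"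
      proof -
        have "(\<Sum>i\<in>I. g i) = g i1 + (\<Sum>i\<in>I - {i1}. g i)"
          by (rule sum.remove[OF \<open>finite I\<close> i1(1)])
        also have "(\<Sum>i\<in>I - {i1}. g i) = g i2 + (\<Sum>i\<in>I - {i1} - {i2}. g i)"
          using i2 \<open>finite I\<close> by (intro sum.remove) auto
        also have "I - {i1} - {i2} = I - {i1, i2}" by auto
        finally show ?thesis by (simp only: add.assoc)
      qed
      have orth': "(\<Sum>i\<in>I. B' k i * B' l i) = (\<Sum>i\<in>I. B k i * B l i)" for k l
      proof -
        have "(\<Sum>i\<in>I - {i1, i2}. B' k i * B' l i) = (\<Sum>i\<in>I - {i1, i2}. B k i * B l i)"
          by (intro sum.cong) (auto simp: B'_def)
        moreover have "B' k i1 * B' l i1 + B' k i2 * B' l i2 = (c\<^sup>2 + s\<^sup>2) * (B k i1 * B l i1 + B k i2 * B l i2)"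
          using i2 by (simp add: B'_def power2_eq_square algebra_simps)
        ultimately show ?thesis using cs by (simp add: split)
      qed
      have "B' j i2 = 0" by (simp add: B'_def c_def s_def)
      then have "{i\<in>I. B' j i \<noteq> 0} \<subset> S"
        using i1 i2 by (auto simp: B'_def S_def split: if_splits)
      then have "card {i\<in>I. B' j i \<noteq> 0} < card {i\<in>I. B j i \<noteq> 0}"
        unfolding S_def[symmetric] using S by (rule psubset_card_mono[rotated])
      then have IH: "(\<integral>\<^sup>+x. f (\<lambda>k\<in>insert j J. \<Sum>i\<in>I. B' k i * x i) \<partial>PiM I (\<lambda>_. G)) =
        (\<integral>\<^sup>+x. f x \<partial>PiM (insert j J) (\<lambda>_. G))"
        by (rule less.hyps) (simp only: orth' less.prems)
      \<comment> \<open>Rotating the input coordinates amounts to rotating the two columns in every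
        row, so the invariance of the Gaussian law replaces \<open>B\<close> by
        \<open>B'\<close>.\<close>
      have "(\<Sum>i\<in>I. B k i * (x(i1 := c * x i1 - s * x i2, i2 := s * x i1 + c * x i2)) i) =
        (\<Sum>i\<in>I. B' k i * x i)" for k x
      proof -
        have "(\<Sum>i\<in>I - {i1, i2}. B k i * (x(i1 := c * x i1 - s * x i2, i2 := s * x i1 + c * x i2)) i) =
          (\<Sum>i\<in>I - {i1, i2}. B' k i * x i)"
          by (intro sum.cong) (auto simp: B'_def)
        then show ?thesis using i2 by (simp add: split B'_def algebra_simps)
      qed
      then have "(\<integral>\<^sup>+x. f (\<lambda>k\<in>insert j J. \<Sum>i\<in>I. B k i * x i) \<partial>PiM I (\<lambda>_. G)) =
        (\<integral>\<^sup>+x. f (\<lambda>k\<in>insert j J. \<Sum>i\<in>I. B' k i * x i) \<partial>PiM I (\<lambda>_. G))"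
        using nn_integral_PiM_normal_rotation[OF assms(2) \<open>finite I\<close> i1(1) i2(1,3) map_meas[unfolded G_def] cs]
        by (simp add: G_def)
      then show ?thesis using IH by simp
    next
      case False
      define I' where "I' = I - {i1}"
      have I: "I = insert i1 I'" "i1 \<notin> I'" "finite I'" using i1 \<open>finite I\<close> by (auto simp: I'_def)
      define a where "a = B j i1"
      have zero: "B j i = 0" if "i \<in> I'" for i
        using False that by (auto simp: S_def I'_def)
      have sumI: "(\<Sum>i\<in>I. g i) = g i1 + (\<Sum>i\<in>I'. g i)" for g :: "'i \<Rightarrow> real"
        using I by simp
      have "a * a = 1" using norm by (simp add: sumI zero a_def)
      then have a: "a = 1 \<or> a = -1" by (simp add: square_eq_1_iff)
      \<comment> \<open>Row \<open>j\<close> is now supported on \<open>i1\<close> alone, so its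
        inner product with row \<open>k\<close> is just the product of their entries there.\<close>
      have row: "B k i1 = 0" if "k \<in> J" for k
      proof -
        have "k \<noteq> j" using that insert.hyps by auto
        then have "B k i1 * a = 0" using less.prems[of k j] that by (simp add: sumI zero a_def)
        then show ?thesis using a by auto
      qed
      have orth': "(\<Sum>i\<in>I'. B k i * B l i) = (if k = l then 1 else 0)" if "k \<in> J" "l \<in> J" for k l
        using less.prems[of k l] that by (simp add: sumI row)
      \<comment> \<open>The integral over the remaining outputs with output \<open>j\<close> held at
        \<open>y\<close>. The outer induction hypothesis, on \<open>J\<close> and \<open>I'\<close>,
        identifies the inner integral with \<open>g (a * y)\<close>.\<close>
      define g where "g y = (\<integral>\<^sup>+\<eta>. f (\<eta>(j := y)) \<partial>PiM J (\<lambda>_. G))" for y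
      interpret PJs: sigma_finite_measure "PiM J (\<lambda>_. G)"
        using insert.hyps by (intro PJ.sigma_finite)
      have upd_meas: "(\<lambda>p. f ((snd p)(j := fst p))) \<in> borel_measurable (G \<Otimes>\<^sub>M PiM J (\<lambda>_. G))"
        using f by measurable
      have g_meas: "g \<in> borel_measurable G"
        unfolding g_def using PJs.borel_measurable_nn_integral_fst[OF upd_meas] by simp
      have "(\<integral>\<^sup>+x. f (\<lambda>k\<in>insert j J. \<Sum>i\<in>I. B k i * x i) \<partial>PiM I (\<lambda>_. G)) =
        (\<integral>\<^sup>+y. \<integral>\<^sup>+x. f (\<lambda>k\<in>insert j J. \<Sum>i\<in>I. B k i * (x(i1 := y)) i) \<partial>PiM I' (\<lambda>_. G) \<partial>G)"
        unfolding I(1) using I by (intro PI.product_nn_integral_insert_rev map_meas[unfolded I(1)])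
      also have "\<dots> = (\<integral>\<^sup>+y. \<integral>\<^sup>+x. f ((\<lambda>k\<in>J. \<Sum>i\<in>I'. B k i * x i)(j := a * y)) \<partial>PiM I' (\<lambda>_. G) \<partial>G)"
      proof -
        have "(\<lambda>k\<in>insert j J. \<Sum>i\<in>I. B k i * (x(i1 := y)) i) = (\<lambda>k\<in>J. \<Sum>i\<in>I'. B k i * x i)(j := a * y)" for x y
        proof -
          have "(\<Sum>i\<in>I'. B k i * (x(i1 := y)) i) = (\<Sum>i\<in>I'. B k i * x i)" for k
            using I by (intro sum.cong) auto
          then show ?thesis
            using zero by (auto simp: fun_eq_iff sumI row a_def restrict_def)
        qed
        then show ?thesis by simp
      qed
      also have "\<dots> = (\<integral>\<^sup>+y. g (a * y) \<partial>G)"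
      proof (rule nn_integral_cong)
        fix y
        have "(\<lambda>\<eta>. \<eta>(j := a * y)) \<in> measurable (PiM J (\<lambda>_. G)) (PiM (insert j J) (\<lambda>_. G))"
          by (rule measurable_fun_upd) (auto simp: G_def)
        from measurable_compose[OF this f]
        have "(\<lambda>\<eta>. f (\<eta>(j := a * y))) \<in> borel_measurable (PiM J (\<lambda>_. G))" .
        from insert.IH[OF I(3) orth' this]
        show "(\<integral>\<^sup>+x. f ((\<lambda>k\<in>J. \<Sum>i\<in>I'. B k i * x i)(j := a * y)) \<partial>PiM I' (\<lambda>_. G)) = g (a * y)"
          by (simp add: g_def fun_upd_def restrict_def)
      qed
      also have "\<dots> = (\<integral>\<^sup>+y. g y \<partial>G)"
      \<comment> \<open>A remaining sign -1 is removed by the symmetry of the centred normal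
        law.\<close>
      proof (cases "a = 1")
        case False
        have "(\<integral>\<^sup>+y. g y \<partial>G) = (\<integral>\<^sup>+y. g y \<partial>distr G borel uminus)"
          unfolding G_def by (simp only: distr_uminus_normal)
        also have "\<dots> = (\<integral>\<^sup>+y. g (- y) \<partial>G)"
          using g_meas by (subst nn_integral_distr) auto
        finally show ?thesis using a False by simp
      qed simp
      also have "\<dots> = (\<integral>\<^sup>+x. f x \<partial>PiM (insert j J) (\<lambda>_. G))"
        unfolding g_def using insert.hyps f by (intro PJ.product_nn_integral_insert_rev[symmetric]) auto
      finally show ?thesis .
    qed
  qed
  from this[of A, OF insert.prems(2)] show ?case .
qed

text \<open>Indicator functions as test functions turn the integral identity into equality of
  laws.\<close>

lemma distr_orthonormal_image_normal:
  fixes A :: "'j \<Rightarrow> 'i \<Rightarrow> real" and \<sigma> :: real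
  defines "G \<equiv> density lborel (normal_density 0 \<sigma>)"
  assumes "0 < \<sigma>" "finite J" "finite I"
    and "\<And>j k. j \<in> J \<Longrightarrow> k \<in> J \<Longrightarrow> (\<Sum>i\<in>I. A j i * A k i) = (if j = k then 1 else 0)"
  shows "distr (PiM I (\<lambda>_. G)) (PiM J (\<lambda>_. G)) (\<lambda>x. \<lambda>j\<in>J. \<Sum>i\<in>I. A j i * x i) = PiM J (\<lambda>_. G)"
proof (rule measure_eqI)
  have [measurable_cong]: "sets G = sets borel" by (simp add: G_def)
  have T: "(\<lambda>x. \<lambda>j\<in>J. \<Sum>i\<in>I. A j i * x i) \<in> measurable (PiM I (\<lambda>_. G)) (PiM J (\<lambda>_. G))"
    by measurable
  fix E assume "E \<in> sets (distr (PiM I (\<lambda>_. G)) (PiM J (\<lambda>_. G)) (\<lambda>x. \<lambda>j\<in>J. \<Sum>i\<in>I. A j i * x i))"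
  then have E: "E \<in> sets (PiM J (\<lambda>_. G))" by simp
  have "emeasure (distr (PiM I (\<lambda>_. G)) (PiM J (\<lambda>_. G)) (\<lambda>x. \<lambda>j\<in>J. \<Sum>i\<in>I. A j i * x i)) E =
    (\<integral>\<^sup>+x. indicator E x \<partial>distr (PiM I (\<lambda>_. G)) (PiM J (\<lambda>_. G)) (\<lambda>x. \<lambda>j\<in>J. \<Sum>i\<in>I. A j i * x i))"
    using E by simp
  also have "\<dots> = (\<integral>\<^sup>+x. indicator E (\<lambda>j\<in>J. \<Sum>i\<in>I. A j i * x i) \<partial>PiM I (\<lambda>_. G))"
    using E by (intro nn_integral_distr[OF T]) simp
  also have "\<dots> = (\<integral>\<^sup>+x. indicator E x \<partial>PiM J (\<lambda>_. G))"
    unfolding G_def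
    by (rule nn_integral_orthonormal_image_normal[OF assms(2-5)]) (use E in \<open>simp_all add: G_def\<close>)
  also have "\<dots> = emeasure (PiM J (\<lambda>_. G)) E" using E by simp
  finally show "emeasure (distr (PiM I (\<lambda>_. G)) (PiM J (\<lambda>_. G)) (\<lambda>x. \<lambda>j\<in>J. \<Sum>i\<in>I. A j i * x i)) E =
    emeasure (PiM J (\<lambda>_. G)) E" .
qed simp

section \<open>The Simes inequality\<close>

lemma measurable_card_sublevel:
  fixes u :: "'a \<Rightarrow> real" and I :: "nat set"
  assumes [measurable]: "u \<in> borel_measurable M"
  shows "(\<lambda>x. card {j\<in>I. u (x j) \<le> c}) \<in> measurable (PiM I (\<lambda>_. M)) (count_space UNIV)"
proof (rule measurable_card)
  fix j show "{x \<in> space (PiM I (\<lambda>_. M)). j \<in> {j\<in>I. u (x j) \<le> c}} \<in> sets (PiM I (\<lambda>_. M))"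
    by (cases "j \<in> I") simp_all
qed

lemma sets_simes_event:
  fixes u :: "'a \<Rightarrow> real" and J :: "nat set" and c :: "nat \<Rightarrow> real"
  assumes "u \<in> borel_measurable M"
  shows "{x \<in> space (PiM J (\<lambda>_. M)). \<exists>v\<in>{1..N}. v \<le> card {j\<in>J. u (x j) \<le> c v}} \<in> sets (PiM J (\<lambda>_. M))"
proof -
  note measurable_card_sublevel[OF assms, measurable]
  show ?thesis by measurable
qed

text \<open>\<open>R\<close> is the Benjamini--Hochberg rejection number and \<open>Ri i\<close> the one obtained after resetting the
  \<open>i\<close>-th p-value to \<open>0\<close>. They agree whenever \<open>i\<close> is rejected, and \<open>Ri i\<close> is independent of coordinate
  \<open>i\<close>, so each summand of \<open>1 = (\<Sum>i rejected. 1 / R)\<close> integrates to at most \<open>\<alpha> / N\<close>.\<close>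
lemma simes_inequality:
  fixes M :: "'a measure" and u :: "'a \<Rightarrow> real" and J :: "nat set"
  assumes "prob_space M" and [measurable]: "u \<in> borel_measurable M"
    and u: "\<And>t. 0 < t \<Longrightarrow> t < 1 \<Longrightarrow> measure M {x \<in> space M. u x \<le> t} \<le> t"
    and "finite J" "0 < \<alpha>" "\<alpha> < 1"
  defines "N \<equiv> card J"
  shows "measure (PiM J (\<lambda>_. M)) {x \<in> space (PiM J (\<lambda>_. M)).
      \<exists>v\<in>{1..N}. v \<le> card {j\<in>J. u (x j) \<le> real v * \<alpha> / N}} \<le> \<alpha>" (is "measure ?P ?E \<le> \<alpha>")
proof -
  note measurable_card_sublevel[OF assms(2), measurable]
  have [measurable]: "?E \<in> sets ?P" by (rule sets_simes_event[OF assms(2)])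
  show "measure ?P ?E \<le> \<alpha>"
  proof (cases "N = 0")
    case True
    then show ?thesis using \<open>0 < \<alpha>\<close> by simp
  next
    case False
    interpret M: prob_space M by fact
    interpret product_sigma_finite "\<lambda>_::nat. M" ..
    interpret P: prob_space ?P by (intro prob_space_PiM assms)
    \<comment> \<open>In \<open>ci\<close> the index \<open>i\<close> is counted whatever its
      p-value, hence the successor. This makes \<open>Ri i\<close> a function of the other
      coordinates and makes 1 always an admissible value, so its maximum is over a nonempty
      set.\<close>
    define K where "K v x = {j\<in>J. u (x j) \<le> real v * \<alpha> / N}" for v x
    define ci where "ci i v x = Suc (card {j\<in>J - {i}. u (x j) \<le> real v * \<alpha> / N})" for i v x
    define R where "R x = Max {v. v \<in> {1..N} \<and> v \<le> card (K v x)}" for x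
    define Ri where "Ri i x = Max {v. v \<in> {1..N} \<and> v \<le> ci i v x}" for i x
    have [measurable]: "Ri i \<in> measurable (PiM (J - {i}) (\<lambda>_. M)) (count_space UNIV)" for i
      unfolding Ri_def ci_def by (rule measurable_Max_nat) measurable
    have cong: "Ri i x = Ri i x'" if "\<And>j. j \<in> J - {i} \<Longrightarrow> x j = x' j" for i x x'
    proof -
      have "{j\<in>J - {i}. u (x j) \<le> real v * \<alpha> / N} = {j\<in>J - {i}. u (x' j) \<le> real v * \<alpha> / N}" for v
        using that by auto
      then show ?thesis by (simp only: Ri_def ci_def)
    qed
    have Ri_meas: "Ri i \<in> measurable ?P (count_space UNIV)" if "i \<in> J" for i
    proof -
      have "Ri i x = Ri i (restrict x (J - {i}))" for x
        by (rule cong) auto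
      moreover have "(\<lambda>x. Ri i (restrict x (J - {i}))) \<in> measurable ?P (count_space UNIV)"
        by (rule measurable_compose[OF measurable_restrict_subset]) auto
      ultimately show ?thesis by simp
    qed
    have Ri_mem: "Ri i x \<in> {1..N} \<and> Ri i x \<le> ci i (Ri i x) x" if "i \<in> J" for i x
    proof -
      have "1 \<in> {v. v \<in> {1..N} \<and> v \<le> ci i v x}"
        using False that \<open>finite J\<close> by (auto simp: ci_def)
      then have "Ri i x \<in> {v. v \<in> {1..N} \<and> v \<le> ci i v x}"
        unfolding Ri_def by (intro Max_in) auto
      then show ?thesis by simp
    qed
    have pt: "indicator ?E x \<le> (\<Sum>i\<in>J. ennreal (1 / Ri i x) * indicator {y. u y \<le> real (Ri i x) * \<alpha> / N} (x i))"
      if x: "x \<in> space ?P" for x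
    proof (cases "x \<in> ?E")
      case True
      have "R x \<in> {v. v \<in> {1..N} \<and> v \<le> card (K v x)}"
        unfolding R_def using True by (intro Max_in) (auto simp: K_def)
      then have R: "R x \<in> {1..N}" "R x \<le> card (K (R x) x)" by auto
      have Rmax: "v \<le> R x" if "v \<in> {1..N}" "v \<le> card (K v x)" for v
        unfolding R_def using that by (intro Max_ge) auto
      \<comment> \<open>Thresholds grow with \<open>v\<close>, so an index rejected at level
        \<open>R x\<close> stays rejected for all larger \<open>v\<close>. There the two counts
        agree, and the two maxima coincide.\<close>
      have RR: "Ri i x = R x" if i: "i \<in> K (R x) x" for i
      proof (rule antisym)
        have iJ: "i \<in> J" using i by (simp add: K_def)
        have eq: "ci i v x = card (K v x)" if "R x \<le> v" for v
        proof -
          have "real (R x) * \<alpha> / N \<le> real v * \<alpha> / N"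
            using that \<open>0 < \<alpha>\<close> by (intro divide_right_mono mult_right_mono) auto
          then have "i \<in> K v x" using i by (auto simp: K_def)
          moreover have "{j\<in>J - {i}. u (x j) \<le> real v * \<alpha> / N} = K v x - {i}" by (auto simp: K_def)
          moreover have "finite (K v x)" using \<open>finite J\<close> by (simp add: K_def)
          ultimately show ?thesis by (simp only: ci_def card_Suc_Diff1)
        qed
        show "R x \<le> Ri i x" unfolding Ri_def using R eq[of "R x"] by (intro Max_ge) auto
        then show "Ri i x \<le> R x" using Rmax Ri_mem[OF iJ, of x] eq by auto
      qed
      \<comment> \<open>Each rejected index contributes \<open>1 / R x\<close> and there are at
        least \<open>R x\<close> of them.\<close>
      have "1 \<le> ennreal (\<Sum>i\<in>K (R x) x. 1 / real (R x))"
        using R by (simp add: field_simps)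
      also have "\<dots> = (\<Sum>i\<in>K (R x) x. ennreal (1 / real (R x)))" by (intro sum_ennreal[symmetric]) simp
      also have "\<dots> = (\<Sum>i\<in>K (R x) x. ennreal (1 / Ri i x) * indicator {y. u y \<le> real (Ri i x) * \<alpha> / N} (x i))"
        by (intro sum.cong) (auto simp: RR K_def)
      also have "\<dots> \<le> (\<Sum>i\<in>J. ennreal (1 / Ri i x) * indicator {y. u y \<le> real (Ri i x) * \<alpha> / N} (x i))"
        using \<open>finite J\<close> by (intro sum_mono2) (auto simp: K_def)
      finally show ?thesis using True by simp
    qed simp
    have each: "(\<integral>\<^sup>+x. ennreal (1 / Ri i x) * indicator {y. u y \<le> real (Ri i x) * \<alpha> / N} (x i) \<partial>?P) \<le> ennreal (\<alpha> / N)"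
      if i: "i \<in> J" for i
    proof -
      define J' where "J' = J - {i}"
      have J: "J = insert i J'" "i \<notin> J'" "finite J'" using i \<open>finite J\<close> by (auto simp: J'_def)
      interpret P': prob_space "PiM J' (\<lambda>_. M)" by (intro prob_space_PiM assms)
      have upd: "Ri i (x(i := y)) = Ri i x" for x y
        by (rule cong) auto
      have [measurable]: "Ri i \<in> measurable (PiM J' (\<lambda>_. M)) (count_space UNIV)" by (simp add: J'_def)
      have [measurable]: "Ri i \<in> measurable (PiM (insert i J') (\<lambda>_. M)) (count_space UNIV)"
        using Ri_meas[OF i] J(1) by simp
      have "(\<integral>\<^sup>+x. ennreal (1 / Ri i x) * indicator {y. u y \<le> real (Ri i x) * \<alpha> / N} (x i) \<partial>?P) =
        (\<integral>\<^sup>+x. (\<integral>\<^sup>+y. ennreal (1 / Ri i x) * indicator {y. u y \<le> real (Ri i x) * \<alpha> / N} y \<partial>M) \<partial>PiM J' (\<lambda>_. M))"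
        unfolding J(1) by (subst product_nn_integral_insert[OF J(3,2)]) (measurable, simp add: upd)
      also have "\<dots> \<le> (\<integral>\<^sup>+x. ennreal (\<alpha> / N) \<partial>PiM J' (\<lambda>_. M))"
      proof (rule nn_integral_mono)
        fix x
        define r where "r = Ri i x"
        have r: "1 \<le> r" "r \<le> N" using Ri_mem[OF i, of x] by (auto simp: r_def)
        \<comment> \<open>Since \<open>r\<close> is at most \<open>N\<close>, the threshold stays
          below 1, inside the range where super-uniformity is assumed.\<close>
        have "real r * \<alpha> / N \<le> \<alpha>" using r \<open>0 < \<alpha>\<close> by (simp add: field_simps)
        moreover have "0 < real r * \<alpha> / N" using r False \<open>0 < \<alpha>\<close> by simp
        ultimately have m: "measure M {y \<in> space M. u y \<le> real r * \<alpha> / N} \<le> real r * \<alpha> / N"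
          using u \<open>\<alpha> < 1\<close> by simp
        have "(\<integral>\<^sup>+y. ennreal (1 / r) * indicator {y. u y \<le> real r * \<alpha> / N} y \<partial>M) =
          (\<integral>\<^sup>+y. ennreal (1 / r) * indicator {y \<in> space M. u y \<le> real r * \<alpha> / N} y \<partial>M)"
          by (intro nn_integral_cong) (auto simp: indicator_def)
        also have "\<dots> = ennreal (1 / r) * ennreal (measure M {y \<in> space M. u y \<le> real r * \<alpha> / N})"
          by (subst nn_integral_cmult_indicator) (auto simp: M.emeasure_eq_measure)
        also have "\<dots> \<le> ennreal (1 / r) * ennreal (real r * \<alpha> / N)"
          using m by (intro mult_left_mono ennreal_leI) auto
        also have "\<dots> = ennreal (\<alpha> / N)" using r \<open>0 < \<alpha>\<close> by (simp flip: ennreal_mult)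
        finally show "(\<integral>\<^sup>+y. ennreal (1 / Ri i x) * indicator {y. u y \<le> real (Ri i x) * \<alpha> / N} y \<partial>M) \<le> ennreal (\<alpha> / N)"
          by (simp add: r_def)
      qed
      also have "\<dots> = ennreal (\<alpha> / N)" by (simp add: P'.emeasure_space_1)
      finally show ?thesis .
    qed
    have "emeasure ?P ?E = (\<integral>\<^sup>+x. indicator ?E x \<partial>?P)" by simp
    also have "\<dots> \<le> (\<integral>\<^sup>+x. (\<Sum>i\<in>J. ennreal (1 / Ri i x) * indicator {y. u y \<le> real (Ri i x) * \<alpha> / N} (x i)) \<partial>?P)"
      using pt by (rule nn_integral_mono)
    also have "\<dots> = (\<Sum>i\<in>J. \<integral>\<^sup>+x. ennreal (1 / Ri i x) * indicator {y. u y \<le> real (Ri i x) * \<alpha> / N} (x i) \<partial>?P)"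
      by (rule nn_integral_sum) (use Ri_meas in measurable)
    also have "\<dots> \<le> (\<Sum>i\<in>J. ennreal (\<alpha> / N))" by (rule sum_mono) (rule each)
    also have "\<dots> = ennreal \<alpha>" using False \<open>0 < \<alpha>\<close> by (simp add: N_def ennreal_of_nat_eq_real_of_nat flip: ennreal_mult)
    finally show ?thesis using \<open>0 < \<alpha>\<close> by (simp add: P.emeasure_eq_measure)
  qed
qed

section \<open>Control of the false discovery proportion\<close>

text \<open>Only \<open>\<bar>X\<^sub>j \<bullet> \<epsilon>\<bar>\<close> for null \<open>j\<close> enters, since \<open>X\<^sub>j \<bullet> y = \<beta>\<^sub>j + X\<^sub>j \<bullet> \<epsilon>\<close>.\<close>
lemma FDP_exceeds_imp_simes_event:
  fixes X :: "nat \<Rightarrow> nat \<Rightarrow> real" and \<beta> \<epsilon> :: "nat \<Rightarrow> real"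
  assumes orth: "\<forall>j<m. \<forall>k<m. (\<Sum>i<n. X i j * X i k) = (if j = k then 1 else 0)"
    and "0 < \<sigma>" "0 < \<alpha>" "\<alpha> < 1" "0 \<le> \<gamma>"
  defines "y \<equiv> \<lambda>i. (\<Sum>j<m. X i j * \<beta> j) + \<epsilon> i"
    and "J \<equiv> {j. j < m \<and> \<beta> j = 0}"
  assumes min: "\<And>b'. fslope_obj n m X \<sigma> \<alpha> \<gamma> y b \<le> fslope_obj n m X \<sigma> \<alpha> \<gamma> y b'"
    and FDP: "\<gamma> < FDP m \<beta> b"
  shows "\<exists>v\<in>{1..card J}. v \<le> card {j\<in>J. 2 * (1 - Phi (\<bar>\<Sum>i<n. X i j * \<epsilon> i\<bar> / \<sigma>)) \<le> real v * \<alpha> / card J}"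
proof -
  define R where "R = num_selected m b"
  define V where "V = num_false m \<beta> b"
  define z where "z j = (\<Sum>i<n. X i j * \<epsilon> i)" for j
  from FDP_level_le_simes[OF \<open>0 < \<alpha>\<close> \<open>0 \<le> \<gamma>\<close> FDP]
  have V: "1 \<le> V" "V \<le> card J" and R: "1 \<le> R" "R \<le> m"
    and lev: "FDP_level m \<alpha> \<gamma> R \<le> real V * \<alpha> / card J"
    by (simp_all add: R_def V_def J_def)
  have small: "2 * (1 - Phi (\<bar>z j\<bar> / \<sigma>)) \<le> real V * \<alpha> / card J" if j: "j \<in> J" "b j \<noteq> 0" for j
  proof -
    have jm: "j < m" "\<beta> j = 0" using j by (auto simp: J_def)
    have "(\<Sum>i<n. X i j * y i) = (\<Sum>k<m. (\<Sum>i<n. X i j * X i k) * \<beta> k) + z j"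
      by (simp add: y_def z_def distrib_left sum.distrib sum_distrib_left sum_distrib_right mult.assoc)
         (rule sum.swap)
    also have "(\<Sum>k<m. (\<Sum>i<n. X i j * X i k) * \<beta> k) = (\<Sum>k<m. if k = j then \<beta> k else 0)"
      using orth jm by (intro sum.cong) auto
    also have "\<dots> = 0" using jm by simp
    finally have "(\<Sum>i<n. X i j * y i) = z j" by simp
    moreover have "\<sigma> * lambda_FDP m \<alpha> \<gamma> R \<le> \<bar>\<Sum>i<n. X i j * y i\<bar>"
      unfolding R_def
    proof (rule fslope_selected_threshold[where b=b and j=j])
      show "lambda_FDP m \<alpha> \<gamma> (num_selected m b) \<le> lambda_FDP m \<alpha> \<gamma> i" if "i \<le> num_selected m b" for i
        using that R(2) \<open>0 < \<alpha>\<close> \<open>\<alpha> < 1\<close> \<open>0 \<le> \<gamma>\<close> by (intro lambda_FDP_antimono) (simp_all add: R_def)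
      show "fslope_obj n m X \<sigma> \<alpha> \<gamma> y b \<le> fslope_obj n m X \<sigma> \<alpha> \<gamma> y b'" for b'
        by (rule min)
    qed (use orth \<open>\<sigma> > 0\<close> jm j in simp_all)
    ultimately have "lambda_FDP m \<alpha> \<gamma> R \<le> \<bar>z j\<bar> / \<sigma>"
      using \<open>\<sigma> > 0\<close> by (simp add: pos_le_divide_eq mult.commute)
    then have "Phi (lambda_FDP m \<alpha> \<gamma> R) \<le> Phi (\<bar>z j\<bar> / \<sigma>)"
      using strict_mono_less_eq[OF Phi_strict_mono] by simp
    then have "2 * (1 - Phi (\<bar>z j\<bar> / \<sigma>)) \<le> FDP_level m \<alpha> \<gamma> R"
      using R assms(3,4) by (simp add: Phi_lambda_FDP)
    with lev show ?thesis by simp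
  qed
  \<comment> \<open>All \<open>V\<close> false selections have null p-values below the threshold for
    \<open>v = V\<close>, which is therefore the witness.\<close>
  have "V = card {j\<in>J. b j \<noteq> 0}"
    unfolding V_def num_false_def J_def by (rule arg_cong[where f=card]) auto
  also have "\<dots> \<le> card {j\<in>J. 2 * (1 - Phi (\<bar>z j\<bar> / \<sigma>)) \<le> real V * \<alpha> / card J}"
    using small by (intro card_mono) (auto simp: J_def)
  finally have "V \<le> card {j\<in>J. 2 * (1 - Phi (\<bar>z j\<bar> / \<sigma>)) \<le> real V * \<alpha> / card J}" .
  moreover have "V \<in> {1..card J}" using V by simp
  ultimately show ?thesis unfolding z_def by blast
qed

text \<open>The event is the preimage of the abstract Simes event under the projection onto the
  columns in \<open>J\<close>, whose image law is again a product of normal laws. The measurability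
  is stated as well, because the final monotonicity argument requires it.\<close>

lemma noise_simes_inequality:
  fixes X :: "nat \<Rightarrow> nat \<Rightarrow> real" and J :: "nat set" and \<sigma> \<alpha> :: real and n :: nat
  assumes orth: "\<And>j k. j \<in> J \<Longrightarrow> k \<in> J \<Longrightarrow> (\<Sum>i<n. X i j * X i k) = (if j = k then 1 else 0)"
    and "finite J" "0 < \<sigma>" "0 < \<alpha>" "\<alpha> < 1"
  defines "E \<equiv> {\<epsilon> \<in> space (noise n \<sigma>). \<exists>v\<in>{1..card J}.
    v \<le> card {j\<in>J. 2 * (1 - Phi (\<bar>\<Sum>i<n. X i j * \<epsilon> i\<bar> / \<sigma>)) \<le> real v * \<alpha> / card J}}"
  shows "E \<in> sets (noise n \<sigma>) \<and> measure (noise n \<sigma>) E \<le> \<alpha>"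
proof -
  define G where "G = density lborel (normal_density 0 \<sigma>)"
  interpret G: prob_space G unfolding G_def using \<open>0 < \<sigma>\<close> by (rule prob_space_normal_density)
  define u where "u z = 2 * (1 - Phi (\<bar>z\<bar> / \<sigma>))" for z
  define E0 where "E0 = {x \<in> space (PiM J (\<lambda>_. G)). \<exists>v\<in>{1..card J}. v \<le> card {j\<in>J. u (x j) \<le> real v * \<alpha> / card J}}"
  have "continuous_on UNIV Phi" using isCont_Phi by (simp add: continuous_at_imp_continuous_on)
  then have [measurable]: "Phi \<in> borel_measurable borel" by (rule borel_measurable_continuous_onI)
  have u: "u \<in> borel_measurable G" unfolding u_def G_def by measurable
  have pval: "measure G {z \<in> space G. u z \<le> t} \<le> t" if "0 < t" "t < 1" for t
    using normal_two_sided_pvalue[OF \<open>0 < \<sigma>\<close> that] by (simp add: u_def G_def)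
  have E0: "E0 \<in> sets (PiM J (\<lambda>_. G))" unfolding E0_def by (rule sets_simes_event[OF u])
  have "measure (PiM J (\<lambda>_. G)) E0 \<le> \<alpha>" unfolding E0_def
    by (rule simes_inequality[OF G.prob_space_axioms u pval \<open>finite J\<close> \<open>0 < \<alpha>\<close> \<open>\<alpha> < 1\<close>])
  moreover have [measurable_cong]: "sets G = sets borel" by (simp add: G_def)
  have T: "(\<lambda>x. \<lambda>j\<in>J. \<Sum>i<n. X i j * x i) \<in> measurable (noise n \<sigma>) (PiM J (\<lambda>_. G))"
    unfolding noise_def G_def[symmetric] by measurable
  have "distr (noise n \<sigma>) (PiM J (\<lambda>_. G)) (\<lambda>x. \<lambda>j\<in>J. \<Sum>i<n. X i j * x i) = PiM J (\<lambda>_. G)"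
    unfolding noise_def G_def
    by (rule distr_orthonormal_image_normal[OF \<open>0 < \<sigma>\<close> \<open>finite J\<close> finite_lessThan orth])
  ultimately have law: "measure (noise n \<sigma>) ((\<lambda>x. \<lambda>j\<in>J. \<Sum>i<n. X i j * x i) -` E0 \<inter> space (noise n \<sigma>)) \<le> \<alpha>"
    using measure_distr[OF T E0] by simp
  have "{j\<in>J. u ((\<lambda>j\<in>J. \<Sum>i<n. X i j * \<epsilon> i) j) \<le> c} = {j\<in>J. u (\<Sum>i<n. X i j * \<epsilon> i) \<le> c}" for \<epsilon> c
    by auto
  moreover have "(\<lambda>j\<in>J. \<Sum>i<n. X i j * \<epsilon> i) \<in> space (PiM J (\<lambda>_. G))" for \<epsilon>
    by (simp add: space_PiM G_def)
  ultimately have E: "E = (\<lambda>x. \<lambda>j\<in>J. \<Sum>i<n. X i j * x i) -` E0 \<inter> space (noise n \<sigma>)"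
    by (auto simp only: E_def E0_def u_def mem_Collect_eq vimage_eq Int_iff)
  show ?thesis using law measurable_sets[OF T E0] unfolding E by simp
qed

theorem theorem5:
  fixes n m :: nat and X :: "nat \<Rightarrow> nat \<Rightarrow> real" and \<beta> :: "nat \<Rightarrow> real"
    and \<sigma> \<alpha> \<gamma> :: real
    and betahat :: "(nat \<Rightarrow> real) \<Rightarrow> (nat \<Rightarrow> real)"
  assumes "n \<ge> m"
    and orth: "\<forall>j<m. \<forall>k<m. (\<Sum>i<n. X i j * X i k) = (if j = k then 1 else 0)"
    and "\<sigma> > 0"
    and "0 < \<alpha>" "\<alpha> < 1" "0 < \<gamma>" "\<gamma> < 1"
    and argmin: "\<forall>y b. fslope_obj n m X \<sigma> \<alpha> \<gamma> y (betahat y) \<le> fslope_obj n m X \<sigma> \<alpha> \<gamma> y b"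
  shows "measure (noise n \<sigma>)
           {\<epsilon> \<in> space (noise n \<sigma>).
              FDP m \<beta> (betahat (\<lambda>i. (\<Sum>j<m. X i j * \<beta> j) + \<epsilon> i)) > \<gamma>} \<le> \<alpha>"
proof -
  define J where "J = {j. j < m \<and> \<beta> j = 0}"
  define E where "E = {\<epsilon> \<in> space (noise n \<sigma>). \<exists>v\<in>{1..card J}.
    v \<le> card {j\<in>J. 2 * (1 - Phi (\<bar>\<Sum>i<n. X i j * \<epsilon> i\<bar> / \<sigma>)) \<le> real v * \<alpha> / card J}}"
  interpret prob_space "noise n \<sigma>"
    unfolding noise_def using \<open>0 < \<sigma>\<close> by (intro prob_space_PiM prob_space_normal_density)
  have orthJ: "(\<Sum>i<n. X i j * X i k) = (if j = k then 1 else 0)" if "j \<in> J" "k \<in> J" for j k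
    using orth that by (simp add: J_def)
  have finJ: "finite J" by (simp add: J_def)
  note E = noise_simes_inequality[OF orthJ finJ \<open>0 < \<sigma>\<close> \<open>0 < \<alpha>\<close> \<open>\<alpha> < 1\<close>, folded E_def]
  \<comment> \<open>Since \<open>betahat\<close> is an arbitrary choice of minimizers, the left-hand
    event is not known to be measurable; inclusion in the measurable set \<open>E\<close> is enough
    to bound its measure.\<close>
  have "{\<epsilon> \<in> space (noise n \<sigma>). FDP m \<beta> (betahat (\<lambda>i. (\<Sum>j<m. X i j * \<beta> j) + \<epsilon> i)) > \<gamma>} \<subseteq> E"
    unfolding E_def J_def
    using FDP_exceeds_imp_simes_event[OF orth \<open>0 < \<sigma>\<close> \<open>0 < \<alpha>\<close> \<open>\<alpha> < 1\<close> less_imp_le[OF \<open>0 < \<gamma>\<close>]] argmin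
    by blast
  then show ?thesis
    using E finite_measure_mono order_trans by blast
qed

end
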